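(* For every nonnegative integer $n$, $$\omega(12n+10)=6B_3(6n+4).$$
   Context: For an integer $n\ge 0$, $\omega(n)$ is the number of ordered tuples $(x_1,x_2,x_3,y_1,y_2,y_3)\in\mathbb{Z}^6$ with $x_1^2+x_2^2+x_3^2+3y_1^2+3y_2^2+3y_3^2=n$. A partition is a 3-core if none of its hook numbers is a multiple of 3 (the empty partition is a 3-core). For an integer $n\ge 0$, $B_3(n)$ denotes the number of partition triples of $n$ with 3-cores, i.e. ordered triples $(\lambda_1,\lambda_2,\lambda_3)$ of (possibly empty) partitions, each a 3-core, such that the sum of all the parts of $\lambda_1,\lambda_2,\lambda_3$ equals $n$; in particular $B_3(0)=1$. Equivalently (a standard fact recalled in the paper), $\sum_{n\ge 0}B_3(n)q^n=\dfrac{f_3^9}{f_1^3}$, where $f_k=\prod_{m=1}^{\infty}(1-q^{km})$. *)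

theory Defs
  imports Main
begin

text \<open>A partition is encoded by the weakly decreasing list of its (positive) parts;
  the empty list is the empty partition.\<close>

definition is_partition :: "nat list \<Rightarrow> bool" where
  "is_partition ps \<longleftrightarrow> sorted_wrt (\<ge>) ps \<and> (\<forall>p\<in>set ps. 0 < p)"

text \<open>Rows and columns of the Young diagram are counted from 0.\<close>

definition young_diagram :: "nat list \<Rightarrow> (nat \<times> nat) set" where
  "young_diagram ps = {(i, j). i < length ps \<and> j < ps ! i}"

text \<open>The hook of a cell consists of the cell itself, the cells to its right in its row, and
  the cells below it in its column.\<close>

definition hook :: "nat list \<Rightarrow> nat \<times> nat \<Rightarrow> (nat \<times> nat) set" where
  "hook ps c = {(i, j) \<in> young_diagram ps.
     (i = fst c \<and> snd c \<le> j) \<or> (j = snd c \<and> fst c \<le> i)}"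

definition hook_number :: "nat list \<Rightarrow> nat \<times> nat \<Rightarrow> nat" where
  "hook_number ps c = card (hook ps c)"

definition is_core :: "nat \<Rightarrow> nat list \<Rightarrow> bool" where
  "is_core t ps \<longleftrightarrow> is_partition ps \<and> (\<forall>c\<in>young_diagram ps. \<not> t dvd hook_number ps c)"

definition B3_triples :: "nat \<Rightarrow> (nat list \<times> nat list \<times> nat list) set" where
  "B3_triples n = {(l1, l2, l3). is_core 3 l1 \<and> is_core 3 l2 \<and> is_core 3 l3 \<and>
     sum_list l1 + sum_list l2 + sum_list l3 = n}"

definition B3 :: "nat \<Rightarrow> nat" where
  "B3 n = card (B3_triples n)"

definition omega_tuples :: "nat \<Rightarrow> (int \<times> int \<times> int \<times> int \<times> int \<times> int) set" where
  "omega_tuples n = {(x1, x2, x3, y1, y2, y3).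
     x1\<^sup>2 + x2\<^sup>2 + x3\<^sup>2 + 3 * y1\<^sup>2 + 3 * y2\<^sup>2 + 3 * y3\<^sup>2 = int n}"

definition omega :: "nat \<Rightarrow> nat" where
  "omega n = card (omega_tuples n)"

text \<open>Both sets are finite, so that \<open>card\<close> really counts their elements.\<close>

lemma finite_B3_triples: "finite (B3_triples n)"
proof -
  let ?L = "{ps :: nat list. set ps \<subseteq> {..n} \<and> length ps \<le> n}"
  have len: "length ps \<le> sum_list ps" if "\<forall>p\<in>set ps. 0 < p" for ps :: "nat list"
    using that by (induction ps) auto
  have L: "ps \<in> ?L" if "is_core 3 ps" "sum_list ps \<le> n" for ps
  proof -
    have pos: "\<forall>p\<in>set ps. 0 < p"
      using that(1) by (simp add: is_core_def is_partition_def)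
    have "set ps \<subseteq> {..n}"
      using member_le_sum_list[of _ ps] that(2) le_trans by blast
    moreover have "length ps \<le> n"
      using len[OF pos] that(2) by (rule le_trans)
    ultimately show ?thesis by blast
  qed
  have "B3_triples n \<subseteq> ?L \<times> ?L \<times> ?L"
  proof (rule subsetI)
    fix v assume "v \<in> B3_triples n"
    then obtain l1 l2 l3 where v: "v = (l1, l2, l3)"
      and core: "is_core 3 l1" "is_core 3 l2" "is_core 3 l3"
      and sum: "sum_list l1 + sum_list l2 + sum_list l3 = n"
      unfolding B3_triples_def by blast
    have "l1 \<in> ?L" "l2 \<in> ?L" "l3 \<in> ?L"
      by (rule L, rule core, use sum in linarith)+
    then show "v \<in> ?L \<times> ?L \<times> ?L"
      unfolding v by (intro SigmaI)
  qed
  moreover have "finite (?L \<times> ?L \<times> ?L)"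
    by (intro finite_cartesian_product finite_lists_length_le) simp_all
  ultimately show ?thesis
    by (rule finite_subset)
qed

lemma finite_omega_tuples: "finite (omega_tuples n)"
proof -
  let ?I = "{- int n..int n}"
  have I: "x \<in> ?I" if "x\<^sup>2 \<le> int n" for x :: int
  proof -
    have "\<bar>x\<bar> \<le> x\<^sup>2"
      using self_le_power[of "\<bar>x\<bar>" 2] by (cases "x = 0") auto
    with that show ?thesis by auto
  qed
  have "omega_tuples n \<subseteq> ?I \<times> ?I \<times> ?I \<times> ?I \<times> ?I \<times> ?I"
  proof (rule subsetI)
    fix v assume "v \<in> omega_tuples n"
    then obtain x1 x2 x3 y1 y2 y3 where v: "v = (x1, x2, x3, y1, y2, y3)"
      and eq: "x1\<^sup>2 + x2\<^sup>2 + x3\<^sup>2 + 3 * y1\<^sup>2 + 3 * y2\<^sup>2 + 3 * y3\<^sup>2 = int n"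
      unfolding omega_tuples_def by blast
    have "0 \<le> x1\<^sup>2" "0 \<le> x2\<^sup>2" "0 \<le> x3\<^sup>2" "0 \<le> y1\<^sup>2" "0 \<le> y2\<^sup>2" "0 \<le> y3\<^sup>2"
      by simp_all
    with eq have "x1\<^sup>2 \<le> int n" "x2\<^sup>2 \<le> int n" "x3\<^sup>2 \<le> int n"
      "y1\<^sup>2 \<le> int n" "y2\<^sup>2 \<le> int n" "y3\<^sup>2 \<le> int n"
      by linarith+
    then show "v \<in> ?I \<times> ?I \<times> ?I \<times> ?I \<times> ?I \<times> ?I"
      unfolding v by (intro SigmaI I)
  qed
  moreover have "finite (?I \<times> ?I \<times> ?I \<times> ?I \<times> ?I \<times> ?I)"
    by simp
  ultimately show ?thesis
    by (rule finite_subset)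
qed

end

theory Submission
  imports Defs "HOL-Computational_Algebra.Formal_Power_Series"
begin

text \<open>Write \<open>m = 6 * n + 5\<close>. Both sides are coefficients of theta series of the ring of Eisenstein integers,
taken at \<open>2 * m\<close> on the left and at \<open>3 * m\<close> on the right.

On the left, \<open>x\<^sup>2 + 3 y\<^sup>2\<close> is the norm form on the Eisenstein integers congruent to 0 or 1 modulo 2, so the
left side is a coefficient of the cube of their theta series (\<open>omega_eq_coeff\<close>). On the right, the
first-column hook numbers of a 3-core form a set closed under subtraction of 3, hence are given by two natural
numbers. The size of the core is a quadratic function of these, and identifies the 3-cores of \<open>k\<close>
with the Eisenstein integers of norm \<open>3 k + 1\<close> that are congruent to 1 modulo \<open>\<surd>-3\<close> and lie in a sector of 120
degrees. There are as many of them as there are integers of this norm congruent to 1 modulo 3. So the right side is a coefficient of the cube of another theta series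
(\<open>B3_eq_coeff\<close>).

Next, both indices are brought down to \<open>m\<close>. The doubling map \<open>(z, w) \<mapsto> (z + w, z - w)\<close> on pairs removes
the factor 2 (\<open>parallelogram\<close>, \<open>omega_double\<close>), and the discrete Fourier transform on triples removes the
factor 3 (\<open>c_series_cube_dissect\<close>). As \<open>m\<close> is odd and congruent to 2 modulo 3, only some of the products
of residue classes modulo 2 and modulo \<open>\<surd>-3\<close> contribute. The results are \<open>omega_dissect\<close> and
\<open>B3_dissect\<close>, two expressions of degree 3 in the same series.

That these expressions agree is not a matter of isometries any more: it needs the quadratic modular
equations between the cubic theta functions \<open>a(q)\<close>, \<open>c(q)\<close>, \<open>a(q\<^sup>2)\<close>, \<open>c(q\<^sup>2)\<close>. These are usually derived
from infinite products. Here they follow from the parallelogram law (\<open>cubic_identities\<close>): its parts in the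
residue classes modulo 3 bound the defect of such an equation by the same defect at \<open>q\<^sup>2\<close> and
\<open>q\<^sup>4\<close>, up to factors with small leading exponents, and a power series whose order of vanishing
exceeds itself is zero. With these equations, the comparison is a short elimination.\<close>

unbundle fps_syntax

section \<open>Theta series and their dilations\<close>
definition dilate :: "nat \<Rightarrow> int fps \<Rightarrow> int fps" where
  "dilate k f = f oo fps_X ^ k"

lemma dilate_nth:
  assumes "0 < k"
  shows "dilate k f $ n = (if k dvd n then f $ (n div k) else 0)"
proof -
  have "dilate k f $ n = (\<Sum>i=0..n. f $ i * (fps_X ^ (k * i)) $ n)"
    by (simp add: dilate_def fps_compose_nth power_mult)
  also have "\<dots> = (\<Sum>i=0..n. if i = n div k then (if k dvd n then f $ i else 0) else 0)"
    using assms by (intro sum.cong) auto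
  also have "\<dots> = (if k dvd n then f $ (n div k) else 0)"
    by (simp add: sum.delta)
  finally show ?thesis .
qed

lemma dilate_add: "dilate k (f + g) = dilate k f + dilate k g"
  by (simp add: dilate_def fps_compose_add_distrib)

lemma dilate_diff: "dilate k (f - g) = dilate k f - dilate k g"
  by (simp add: dilate_def fps_compose_sub_distrib)

lemma dilate_mult: "0 < k \<Longrightarrow> dilate k (f * g) = dilate k f * dilate k g"
  by (simp add: dilate_def fps_compose_mult_distrib)

lemma dilate_power: "0 < k \<Longrightarrow> dilate k (f ^ n) = dilate k f ^ n"
  by (simp add: dilate_def fps_compose_power)

lemma dilate_numeral: "0 < k \<Longrightarrow> dilate k (numeral m) = numeral m"
  by (auto simp: fps_eq_iff dilate_nth fps_numeral_nth)

lemma dilate_dilate: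
  "0 < k \<Longrightarrow> 0 < l \<Longrightarrow> dilate k (dilate l f) = dilate (k * l) f"
  by (auto simp: fps_eq_iff dilate_nth div_mult2_eq dvd_mult_imp_div mult.commute
      elim: dvd_mult_left dvd_mult_right)

lemmas dilate_simps = dilate_add dilate_diff dilate_mult dilate_power dilate_numeral dilate_dilate

text \<open>The generating function of a set by weight. A coefficient is a genuine count only when the
corresponding fibre of the weight is finite, which is what \<open>graded\<close> records.\<close>
definition theta :: "('a \<Rightarrow> int) \<Rightarrow> 'a set \<Rightarrow> int fps" where
  "theta f S = Abs_fps (\<lambda>n. int (card {x\<in>S. f x = int n}))"

definition graded :: "('a \<Rightarrow> int) \<Rightarrow> 'a set \<Rightarrow> bool" where
  "graded f S \<longleftrightarrow> (\<forall>x\<in>S. 0 \<le> f x) \<and> (\<forall>n. finite {x\<in>S. f x = n})"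

lemma theta_nth: "theta f S $ n = int (card {x\<in>S. f x = int n})"
  by (simp add: theta_def)

lemma graded_subset: "graded f T \<Longrightarrow> S \<subseteq> T \<Longrightarrow> graded f S"
  unfolding graded_def by (blast intro: finite_subset[rotated])

lemma graded_times:
  assumes "graded f S" "graded g T"
  shows "graded (\<lambda>(x, y). f x + g y) (S \<times> T)"
  unfolding graded_def
proof (intro conjI allI ballI)
  show "0 \<le> (case z of (x, y) \<Rightarrow> f x + g y)" if "z \<in> S \<times> T" for z
    using assms that by (auto simp: graded_def)
  fix n
  have "{z \<in> S \<times> T. (case z of (x, y) \<Rightarrow> f x + g y) = n}
      \<subseteq> (\<Union>i\<in>{0..n}. {x\<in>S. f x = i} \<times> {y\<in>T. g y = n - i})"
    using assms by (force simp: graded_def)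
  then show "finite {z \<in> S \<times> T. (case z of (x, y) \<Rightarrow> f x + g y) = n}"
    by (rule finite_subset) (use assms in \<open>auto simp: graded_def\<close>)
qed

lemma theta_times:
  assumes "graded f S" "graded g T"
  shows "theta f S * theta g T = theta (\<lambda>(x, y). f x + g y) (S \<times> T)"
proof (rule fps_ext)
  fix n
  let ?A = "\<lambda>i. {x\<in>S. f x = int i} \<times> {y\<in>T. g y = int (n - i)}"
  have "{z \<in> S \<times> T. (case z of (x, y) \<Rightarrow> f x + g y) = int n} = (\<Union>i\<in>{0..n}. ?A i)"
  proof (intro equalityI subsetI)
    fix z assume "z \<in> {z \<in> S \<times> T. (case z of (x, y) \<Rightarrow> f x + g y) = int n}"
    then obtain x y where z: "z = (x, y)" "x \<in> S" "y \<in> T" "f x + g y = int n" by auto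
    then have "0 \<le> f x" "0 \<le> g y" using assms by (auto simp: graded_def)
    with z have "z \<in> ?A (nat (f x))" "nat (f x) \<in> {0..n}" by auto
    then show "z \<in> (\<Union>i\<in>{0..n}. ?A i)" by blast
  qed auto
  moreover have "card (\<Union>i\<in>{0..n}. ?A i) = (\<Sum>i=0..n. card (?A i))"
    using assms by (intro card_UN_disjoint) (auto simp: graded_def)
  ultimately show "(theta f S * theta g T) $ n = theta (\<lambda>(x, y). f x + g y) (S \<times> T) $ n"
    by (simp add: fps_mult_nth theta_nth card_cartesian_product)
qed

lemma theta_reindex:
  assumes "bij_betw h S T" "\<And>x. x \<in> S \<Longrightarrow> g (h x) = f x"
  shows "theta f S = theta g T"
proof (rule fps_ext)
  fix n
  have "bij_betw h {x\<in>S. f x = int n} {y\<in>T. g y = int n}"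
    using assms by (auto simp: bij_betw_def inj_on_def image_iff)
  then show "theta f S $ n = theta g T $ n"
    by (simp add: theta_nth bij_betw_same_card)
qed

lemma theta_Un:
  assumes "graded f (S \<union> T)" "S \<inter> T = {}"
  shows "theta f (S \<union> T) = theta f S + theta f T"
proof (rule fps_ext)
  fix n
  have "{x\<in>S \<union> T. f x = int n} = {x\<in>S. f x = int n} \<union> {x\<in>T. f x = int n}" by auto
  moreover have "finite {x\<in>S. f x = int n}" "finite {x\<in>T. f x = int n}"
    using assms(1) by (auto simp: graded_def intro: finite_subset[rotated])
  ultimately show "theta f (S \<union> T) $ n = (theta f S + theta f T) $ n"
    using assms(2) by (subst fps_add_nth) (auto simp: theta_nth card_Un_disjoint disjoint_iff)
qed

lemma theta_scale:
  assumes "0 < k"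
  shows "theta (\<lambda>x. int k * f x) S = dilate k (theta f S)"
proof (rule fps_ext)
  fix n
  show "theta (\<lambda>x. int k * f x) S $ n = dilate k (theta f S) $ n"
  proof (cases "k dvd n")
    case True
    then obtain m where "n = k * m" ..
    then show ?thesis using assms by (simp add: theta_nth dilate_nth)
  next
    case False
    then have "int k * f x \<noteq> int n" for x
      by (metis dvd_triv_left int_dvd_int_iff)
    then show ?thesis using False assms by (simp add: theta_nth dilate_nth)
  qed
qed

text \<open>A map of order 3 that preserves the weight cuts \<open>R\<close> into orbits, and \<open>S\<close> contains exactly
one point of each. Most of the series below are compared in this way, with multiplication by a
cube root of unity as the map.\<close>
lemma theta_orbit3:
  assumes graded: "graded f R" and sub: "S \<subseteq> R"
    and \<rho>: "\<And>x. \<rho> (\<rho> (\<rho> x)) = x" "\<And>x. x \<in> R \<Longrightarrow> \<rho> x \<in> R" "\<And>x. x \<in> R \<Longrightarrow> f (\<rho> x) = f x"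
    and ex: "\<And>x. x \<in> R \<Longrightarrow> x \<in> S \<or> \<rho> x \<in> S \<or> \<rho> (\<rho> x) \<in> S"
    and uniq: "\<And>x. x \<in> S \<Longrightarrow> \<rho> x \<notin> S"
  shows "theta f R = 3 * theta f S"
proof -
  let ?S1 = "{x\<in>R. \<rho> x \<in> S}" and ?S2 = "{x\<in>R. \<rho> (\<rho> x) \<in> S}"
  have R: "R = S \<union> (?S1 \<union> ?S2)" using sub ex by auto
  have disj: "S \<inter> (?S1 \<union> ?S2) = {}" "?S1 \<inter> ?S2 = {}"
    by (auto dest: uniq) (metis \<rho>(1) uniq)
  have "theta f R = theta f S + (theta f ?S1 + theta f ?S2)"
    using theta_Un[of f S "?S1 \<union> ?S2"] theta_Un[of f ?S1 ?S2] disj R graded graded_subset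
    by (metis (no_types, lifting) Un_upper2)
  moreover have "theta f ?S1 = theta f S"
  proof (rule theta_reindex)
    show "bij_betw \<rho> ?S1 S"
      by (rule bij_betw_byWitness[where f' = "\<lambda>x. \<rho> (\<rho> x)"]) (use \<rho> sub in auto)
  qed (use \<rho> in auto)
  moreover have "theta f ?S2 = theta f S"
  proof (rule theta_reindex)
    show "bij_betw (\<lambda>x. \<rho> (\<rho> x)) ?S2 S"
      by (rule bij_betw_byWitness[where f' = \<rho>]) (use \<rho> sub in auto)
  qed (use \<rho> in auto)
  ultimately show ?thesis by simp
qed

section \<open>Theta series of the Eisenstein integers\<close>
text \<open>The pair \<open>(x, y)\<close> stands for \<open>x + y \<omega>\<close>, where \<open>\<omega>\<close> is a primitive cube root of unity,
and \<open>\<theta> = 1 + 2 \<omega>\<close> is a square root of \<open>- 3\<close>.\<close>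
type_synonym eisenstein = "int \<times> int"

fun eis_norm :: "eisenstein \<Rightarrow> int" where
  "eis_norm (x, y) = x\<^sup>2 - x * y + y\<^sup>2"

fun mult_\<omega> :: "eisenstein \<Rightarrow> eisenstein" where
  "mult_\<omega> (x, y) = (- y, x - y)"

fun mult_\<theta> :: "eisenstein \<Rightarrow> eisenstein" where
  "mult_\<theta> (x, y) = (x - 2 * y, 2 * x - y)"

lemma mult_\<omega>_cube: "mult_\<omega> (mult_\<omega> (mult_\<omega> z)) = z"
  by (cases z) simp

lemma eis_norm_mult_\<omega>: "eis_norm (mult_\<omega> z) = eis_norm z"
  by (cases z) (simp add: power2_eq_square algebra_simps)

lemma eis_norm_mult_\<theta>: "eis_norm (mult_\<theta> z) = 3 * eis_norm z"
  by (cases z) (simp add: power2_eq_square algebra_simps)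

lemma eis_norm_bounds: "3 * x\<^sup>2 \<le> 4 * eis_norm (x, y)" "3 * y\<^sup>2 \<le> 4 * eis_norm (x, y)"
proof -
  have "4 * eis_norm (x, y) - 3 * x\<^sup>2 = (x - 2 * y)\<^sup>2" "4 * eis_norm (x, y) - 3 * y\<^sup>2 = (2 * x - y)\<^sup>2"
    by (simp_all add: power2_eq_square algebra_simps)
  then show "3 * x\<^sup>2 \<le> 4 * eis_norm (x, y)" "3 * y\<^sup>2 \<le> 4 * eis_norm (x, y)"
    by (smt (verit) zero_le_power2)+
qed

lemma eis_norm_nonneg: "0 \<le> eis_norm z"
  using eis_norm_bounds(1) by (cases z) (smt (verit) zero_le_power2)

lemma abs_le_square: "\<bar>x\<bar> \<le> x\<^sup>2" for x :: int
  using self_le_power[of "\<bar>x\<bar>" 2] by (cases "x = 0") auto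

lemma graded_eis_norm: "graded eis_norm S"
proof -
  have "finite {z. eis_norm z = n}" for n
  proof (rule finite_subset)
    show "{z. eis_norm z = n} \<subseteq> {-2*n..2*n} \<times> {-2*n..2*n}"
    proof
      fix z assume "z \<in> {z. eis_norm z = n}"
      then obtain x y where z: "z = (x, y)" "eis_norm (x, y) = n" by (cases z) auto
      have "3 * \<bar>x\<bar> \<le> 4 * n" "3 * \<bar>y\<bar> \<le> 4 * n"
        using eis_norm_bounds(1)[of x y] eis_norm_bounds(2)[of y x] abs_le_square[of x] abs_le_square[of y]
        unfolding z(2) by linarith+
      then show "z \<in> {-2*n..2*n} \<times> {-2*n..2*n}" using z(1) by auto
    qed
  qed simp
  then have "graded eis_norm UNIV" by (simp add: graded_def eis_norm_nonneg)
  then show ?thesis by (rule graded_subset) simp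
qed

definition zero_mod_2 :: "eisenstein set" where
  "zero_mod_2 = {(x, y). even x \<and> even y}"

definition one_mod_2 :: "eisenstein set" where
  "one_mod_2 = {(x, y). odd x \<and> even y}"

definition one_mod_3 :: "eisenstein set" where
  "one_mod_3 = {(x, y). 3 dvd x - 1 \<and> 3 dvd y}"

text \<open>The quotient by \<open>\<theta>\<close> is the field with three elements; since \<open>\<omega>\<close> is congruent to 1 modulo
\<open>\<theta>\<close>, the residue of \<open>x + y \<omega>\<close> is that of \<open>x + y\<close>.\<close>
definition mod_\<theta> :: "int \<Rightarrow> eisenstein set" where
  "mod_\<theta> r = {(x, y). 3 dvd x + y - r}"

lemma mem_eis_sets:
  "(x, y) \<in> zero_mod_2 \<longleftrightarrow> 2 dvd x \<and> 2 dvd y"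
  "(x, y) \<in> one_mod_2 \<longleftrightarrow> \<not> 2 dvd x \<and> 2 dvd y"
  "(x, y) \<in> one_mod_3 \<longleftrightarrow> 3 dvd x - 1 \<and> 3 dvd y"
  "(x, y) \<in> mod_\<theta> r \<longleftrightarrow> 3 dvd x + y - r"
  by (simp_all add: zero_mod_2_def one_mod_2_def one_mod_3_def mod_\<theta>_def)

lemmas eis_mem = mem_eis_sets Int_iff Diff_iff Compl_iff

text \<open>With \<open>q = t ^ 3\<close>, the cubic theta functions of the Borwein brothers are \<open>a(q) = dilate 3 a_series\<close>
and \<open>c(q) = 3 * c_series\<close>. The terms with odd exponents form the series \<open>3 * o_series\<close> in \<open>a_series\<close>,
and the series \<open>co_series\<close> in \<open>c_series\<close>.\<close>
definition "a_series = theta eis_norm UNIV"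
definition "o_series = theta eis_norm one_mod_2"
definition "c_series = theta eis_norm one_mod_3"
definition "co_series = theta eis_norm (mod_\<theta> 1 \<inter> one_mod_2)"

text \<open>The three units \<open>1\<close>, \<open>\<omega>\<close>, \<open>\<omega>\<^sup>2\<close> represent the nonzero classes modulo 2, and also the classes
modulo 3 that are congruent to 1 modulo \<open>\<theta>\<close>. So rotation by \<open>\<omega>\<close> relates all elements prime to 2,
or all elements congruent to 1 modulo \<open>\<theta>\<close>, to a single class.\<close>
lemma theta_mult_\<omega>:
  assumes "\<And>x y. (x, y) \<in> S \<Longrightarrow> (x, y) \<in> R" "\<And>x y. (x, y) \<in> R \<Longrightarrow> (- y, x - y) \<in> R"
    and "\<And>x y. (x, y) \<in> R \<Longrightarrow> (x, y) \<in> S \<or> (- y, x - y) \<in> S \<or> (y - x, - x) \<in> S"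
    and "\<And>x y. (x, y) \<in> S \<Longrightarrow> (- y, x - y) \<notin> S"
  shows "theta eis_norm R = 3 * theta eis_norm S"
proof (rule theta_orbit3[where \<rho> = mult_\<omega>, OF graded_eis_norm])
  show "z \<in> S \<or> mult_\<omega> z \<in> S \<or> mult_\<omega> (mult_\<omega> z) \<in> S" if "z \<in> R" for z
    using that assms(3) by (cases z) simp
qed (use assms in \<open>auto simp: mult_\<omega>_cube eis_norm_mult_\<omega> simp del: eis_norm.simps\<close>)

lemma theta_split:
  assumes "S \<inter> T = {}"
  shows "theta eis_norm (S \<union> T) = theta eis_norm S + theta eis_norm T"
  using assms by (rule theta_Un[OF graded_eis_norm])

lemma theta_even: "theta eis_norm zero_mod_2 = dilate 4 a_series"
proof -
  have "bij_betw (\<lambda>(x, y). (2 * x, 2 * y)) UNIV zero_mod_2"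
    by (rule bij_betw_byWitness[where f' = "\<lambda>(x, y). (x div 2, y div 2)"]) (auto simp: mem_eis_sets)
  then have "theta (\<lambda>z. int 4 * eis_norm z) UNIV = theta eis_norm zero_mod_2"
    by (rule theta_reindex) (auto simp: power2_eq_square algebra_simps)
  then show ?thesis using theta_scale[of 4 eis_norm UNIV] by (simp add: a_series_def)
qed

lemma theta_odd: "theta eis_norm (- zero_mod_2) = 3 * o_series"
  unfolding o_series_def
  by (rule theta_mult_\<omega>) (unfold eis_mem, presburger+)

lemma a_series_mod_2: "a_series = dilate 4 a_series + 3 * o_series"
  using theta_split[OF Compl_disjoint, of zero_mod_2]
  unfolding Compl_partition theta_even theta_odd a_series_def[symmetric] .

lemma bij_betw_mult_\<theta>:
  assumes "\<And>z. mult_\<theta> z \<in> S \<longleftrightarrow> z \<in> S"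
  shows "bij_betw mult_\<theta> S (mod_\<theta> 0 \<inter> S)"
proof -
  have inj: "inj_on mult_\<theta> S" by (auto simp: inj_on_def)
  have "mult_\<theta> z \<in> mod_\<theta> 0" for z
    by (cases z) (simp only: eis_mem mult_\<theta>.simps, presburger)
  moreover have "\<exists>w. mult_\<theta> w = z" if z0: "z \<in> mod_\<theta> 0" for z
  proof -
    obtain x y where z: "z = (x, y)" by (cases z)
    then obtain k where "x + y = 3 * k" using z0 by (auto simp: mem_eis_sets dvd_def)
    then have "mult_\<theta> (y - k, k - x) = z" using z by simp
    then show ?thesis ..
  qed
  ultimately have "mult_\<theta> ` S = mod_\<theta> 0 \<inter> S" using assms by blast
  with inj show ?thesis by (simp add: bij_betw_def)
qed

lemma theta_mod_\<theta>_minus: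
  assumes neg: "\<And>x y. (- x, - y) \<in> S \<longleftrightarrow> (x, y) \<in> S"
  shows "theta eis_norm (mod_\<theta> (- 1) \<inter> S) = theta eis_norm (mod_\<theta> 1 \<inter> S)"
proof -
  have minus: "(- x, - y) \<in> mod_\<theta> (- r) \<longleftrightarrow> (x, y) \<in> mod_\<theta> r" for x y r
    unfolding eis_mem by presburger
  have "bij_betw (\<lambda>(x, y). (- x, - y)) (mod_\<theta> (- 1) \<inter> S) (mod_\<theta> 1 \<inter> S)"
    by (rule bij_betw_byWitness[where f' = "\<lambda>(x, y). (- x, - y)"])
       (auto simp: neg minus minus[of _ _ "- 1", simplified])
  then show ?thesis by (rule theta_reindex) auto
qed

text \<open>The multiples of \<open>\<theta>\<close> in \<open>S\<close> are \<open>\<theta>\<close> times \<open>S\<close>, and negation exchanges the two nonzero classes.\<close>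
lemma theta_mod_\<theta>_split:
  assumes \<theta>: "\<And>z. mult_\<theta> z \<in> S \<longleftrightarrow> z \<in> S" and neg: "\<And>x y. (- x, - y) \<in> S \<longleftrightarrow> (x, y) \<in> S"
  shows "theta eis_norm S = dilate 3 (theta eis_norm S) + 2 * theta eis_norm (mod_\<theta> 1 \<inter> S)"
proof -
  have "theta (\<lambda>z. int 3 * eis_norm z) S = theta eis_norm (mod_\<theta> 0 \<inter> S)"
    by (rule theta_reindex[OF bij_betw_mult_\<theta>[OF \<theta>]]) (simp add: eis_norm_mult_\<theta>)
  then have 0: "theta eis_norm (mod_\<theta> 0 \<inter> S) = dilate 3 (theta eis_norm S)"
    using theta_scale[of 3 eis_norm S] by simp
  have cover: "z \<in> mod_\<theta> 0 \<or> z \<in> mod_\<theta> 1 \<or> z \<in> mod_\<theta> (- 1)" for z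
    by (cases z) (simp only: eis_mem, presburger)
  have disj: "\<not> (z \<in> mod_\<theta> 0 \<and> z \<in> mod_\<theta> 1)" "\<not> (z \<in> mod_\<theta> 0 \<and> z \<in> mod_\<theta> (- 1))"
    "\<not> (z \<in> mod_\<theta> 1 \<and> z \<in> mod_\<theta> (- 1))" for z
    by (cases z; simp only: eis_mem; presburger)+
  have "S = mod_\<theta> 0 \<inter> S \<union> (mod_\<theta> 1 \<inter> S \<union> mod_\<theta> (- 1) \<inter> S)"
    using cover by blast
  then have "theta eis_norm S = theta eis_norm (mod_\<theta> 0 \<inter> S \<union> (mod_\<theta> 1 \<inter> S \<union> mod_\<theta> (- 1) \<inter> S))"
    by simp
  also have "\<dots> = theta eis_norm (mod_\<theta> 0 \<inter> S) + theta eis_norm (mod_\<theta> 1 \<inter> S \<union> mod_\<theta> (- 1) \<inter> S)"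
    by (rule theta_split) (use disj in blast)
  also have "theta eis_norm (mod_\<theta> 1 \<inter> S \<union> mod_\<theta> (- 1) \<inter> S) =
      theta eis_norm (mod_\<theta> 1 \<inter> S) + theta eis_norm (mod_\<theta> (- 1) \<inter> S)"
    by (rule theta_split) (use disj in blast)
  finally show ?thesis unfolding 0 theta_mod_\<theta>_minus[OF neg] mult_2 .
qed

lemma theta_mod_\<theta>_1: "theta eis_norm (mod_\<theta> 1) = 3 * c_series"
  unfolding c_series_def
  by (rule theta_mult_\<omega>) (unfold eis_mem, presburger+)

lemma a_series_mod_3: "a_series = dilate 3 a_series + 6 * c_series"
proof -
  have "theta eis_norm UNIV = dilate 3 (theta eis_norm UNIV) + 2 * theta eis_norm (mod_\<theta> 1 \<inter> UNIV)"
    by (rule theta_mod_\<theta>_split) simp_all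
  moreover have "2 * (3 * c_series) = 6 * c_series" by simp
  ultimately show ?thesis
    unfolding Int_UNIV_right theta_mod_\<theta>_1 a_series_def[symmetric] by metis
qed

lemma o_series_mod_3: "o_series = dilate 3 o_series + 2 * co_series"
  unfolding co_series_def o_series_def
proof (rule theta_mod_\<theta>_split)
  show "mult_\<theta> z \<in> one_mod_2 \<longleftrightarrow> z \<in> one_mod_2" for z
    by (cases z) (simp add: mem_eis_sets)
qed (simp add: mem_eis_sets)

text \<open>The even elements of \<open>one_mod_3\<close> are its multiples by \<open>- 2\<close>. The odd ones differ from
\<open>mod_\<theta> 1 \<inter> one_mod_2\<close> as a set, but both sets meet every orbit of \<open>\<omega>\<close> on the odd elements of \<open>mod_\<theta> 1\<close>
exactly once.\<close>
lemma c_series_mod_2: "c_series = dilate 4 c_series + co_series"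
proof -
  have "bij_betw (\<lambda>(x, y). (- 2 * x, - 2 * y)) one_mod_3 (one_mod_3 \<inter> zero_mod_2)"
    unfolding bij_betw_def
  proof (intro conjI equalityI subsetI)
    show "inj_on (\<lambda>(x, y). (- 2 * x, - 2 * y)) one_mod_3" by (auto simp: inj_on_def)
    show "z \<in> one_mod_3 \<inter> zero_mod_2" if "z \<in> (\<lambda>(x, y). (- 2 * x, - 2 * y)) ` one_mod_3" for z
    proof -
      from that obtain x y where "z = (- 2 * x, - 2 * y)" "(x, y) \<in> one_mod_3" by auto
      then show ?thesis by (simp only: eis_mem) presburger
    qed
    show "z \<in> (\<lambda>(x, y). (- 2 * x, - 2 * y)) ` one_mod_3" if "z \<in> one_mod_3 \<inter> zero_mod_2" for z
    proof -
      obtain x y where z: "z = (x, y)" by (cases z)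
      with that have "even (- x)" "even (- y)" by (auto simp: mem_eis_sets)
      then obtain u v where uv: "x = - 2 * u" "y = - 2 * v" by (metis evenE minus_equation_iff mult_minus_left)
      with that z have "(u, v) \<in> one_mod_3" by (simp only: eis_mem) presburger
      with z uv show ?thesis by force
    qed
  qed
  then have "theta (\<lambda>z. int 4 * eis_norm z) one_mod_3 = theta eis_norm (one_mod_3 \<inter> zero_mod_2)"
    by (rule theta_reindex) (auto simp: power2_eq_square algebra_simps)
  then have E: "theta eis_norm (one_mod_3 \<inter> zero_mod_2) = dilate 4 c_series"
    using theta_scale[of 4 eis_norm one_mod_3] by (simp add: c_series_def)
  have "theta eis_norm (mod_\<theta> 1 - zero_mod_2) = 3 * theta eis_norm (one_mod_3 - zero_mod_2)"
    by (rule theta_mult_\<omega>) (unfold eis_mem, presburger+)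
  moreover have "theta eis_norm (mod_\<theta> 1 - zero_mod_2) = 3 * co_series"
    unfolding co_series_def
    by (rule theta_mult_\<omega>) (unfold eis_mem, presburger+)
  ultimately have "3 * theta eis_norm (one_mod_3 - zero_mod_2) = 3 * co_series" by simp
  then have O: "theta eis_norm (one_mod_3 - zero_mod_2) = co_series"
    by (simp add: fps_eq_iff numeral_fps_const)
  have "c_series = theta eis_norm (one_mod_3 \<inter> zero_mod_2 \<union> (one_mod_3 - zero_mod_2))"
    by (simp add: c_series_def Un_Diff_Int Int_Diff_Un)
  also have "\<dots> = theta eis_norm (one_mod_3 \<inter> zero_mod_2) + theta eis_norm (one_mod_3 - zero_mod_2)"
    by (rule theta_split) auto
  finally show ?thesis unfolding E O .
qed

text \<open>The map \<open>(z, w) \<mapsto> (z + w, z - w)\<close> doubles the sum of norms, and its image consists of the pairs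
with congruent entries modulo 2: two even entries, or two odd ones in one of three classes.\<close>
lemma parallelogram: "(dilate 2 a_series)\<^sup>2 = (dilate 4 a_series)\<^sup>2 + 3 * o_series\<^sup>2"
proof -
  let ?N = "\<lambda>(z, w). eis_norm z + eis_norm w"
  let ?P = "{((x :: int, y :: int), (u :: int, v :: int)). even (x + u) \<and> even (y + v)}"
  let ?Q = "?P - zero_mod_2 \<times> zero_mod_2"
  note times = theta_times[OF graded_eis_norm graded_eis_norm]
  have graded: "graded ?N S" for S
    using graded_subset[OF graded_times[OF graded_eis_norm[of UNIV] graded_eis_norm[of UNIV]]] by simp
  have "bij_betw (\<lambda>((x, y), (u, v)). ((x + u, y + v), (x - u, y - v))) UNIV ?P"
    unfolding bij_betw_def
  proof (intro conjI equalityI subsetI)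
    show "p \<in> range (\<lambda>((x, y), (u, v)). ((x + u, y + v), (x - u, y - v)))" if "p \<in> ?P" for p
    proof -
      from that obtain x y u v where p: "p = ((x, y), (u, v))" "even (x + u)" "even (y + v)" by auto
      obtain k where "x + u = 2 * k" using p(2) by (rule evenE)
      moreover obtain l where "y + v = 2 * l" using p(3) by (rule evenE)
      ultimately have "p = (\<lambda>((x, y), (u, v)). ((x + u, y + v), (x - u, y - v))) ((k, l), (x - k, y - l))"
        using p(1) by simp
      then show ?thesis by blast
    qed
  qed (auto simp: inj_on_def)
  then have "theta (\<lambda>p. int 2 * ?N p) (UNIV \<times> UNIV) = theta ?N ?P"
    unfolding UNIV_Times_UNIV
    by (rule theta_reindex) (auto simp: power2_eq_square algebra_simps)
  then have "theta ?N ?P = dilate 2 (a_series\<^sup>2)"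
    using theta_scale[of 2 ?N "UNIV \<times> UNIV"] times[of UNIV UNIV]
    by (simp add: a_series_def power2_eq_square)
  moreover have "theta ?N ?P = theta ?N (zero_mod_2 \<times> zero_mod_2) + theta ?N ?Q"
  proof -
    have "?P = zero_mod_2 \<times> zero_mod_2 \<union> ?Q" by (auto simp: zero_mod_2_def)
    then show ?thesis using theta_Un[of ?N "zero_mod_2 \<times> zero_mod_2" ?Q] graded by auto
  qed
  moreover have "theta ?N (zero_mod_2 \<times> zero_mod_2) = (dilate 4 a_series)\<^sup>2"
    by (simp add: times[symmetric] theta_even power2_eq_square)
  moreover have "theta ?N ?Q = 3 * theta ?N (one_mod_2 \<times> one_mod_2)"
  proof (rule theta_orbit3[where \<rho> = "\<lambda>(z, w). (mult_\<omega> z, mult_\<omega> w)", OF graded])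
    show "one_mod_2 \<times> one_mod_2 \<subseteq> ?Q" by (auto simp: mem_eis_sets)
    show "?N ((\<lambda>(z, w). (mult_\<omega> z, mult_\<omega> w)) p) = ?N p" for p
      by (simp add: case_prod_beta eis_norm_mult_\<omega>)
  qed (auto simp: mult_\<omega>_cube mem_eis_sets)
  ultimately show ?thesis
    by (simp add: times[symmetric] o_series_def[symmetric] power2_eq_square dilate_mult)
qed

section \<open>Residue classes of exponents\<close>
definition supported :: "nat \<Rightarrow> nat \<Rightarrow> int fps \<Rightarrow> bool" where
  "supported m r f \<longleftrightarrow> (\<forall>n. f $ n \<noteq> 0 \<longrightarrow> n mod m = r mod m)"

lemma supported_nth: "supported m r f \<Longrightarrow> n mod m \<noteq> r mod m \<Longrightarrow> f $ n = 0"
  by (auto simp: supported_def)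

lemma supported_cong: "supported m r f \<Longrightarrow> r mod m = s mod m \<Longrightarrow> supported m s f"
  by (simp add: supported_def)

lemma supported_add: "supported m r f \<Longrightarrow> supported m r g \<Longrightarrow> supported m r (f + g)"
  by (auto simp: supported_def) (metis add.right_neutral)

lemma supported_diff: "supported m r f \<Longrightarrow> supported m r g \<Longrightarrow> supported m r (f - g)"
  by (auto simp: supported_def) (metis diff_zero)

lemma supported_mult:
  assumes "supported m r f" "supported m s g"
  shows "supported m (r + s) (f * g)"
  unfolding supported_def
proof (intro allI impI)
  fix n assume "(f * g) $ n \<noteq> 0"
  then obtain i where i: "i \<le> n" "f $ i * g $ (n - i) \<noteq> 0"
    unfolding fps_mult_nth by (auto elim: sum.not_neutral_contains_not_neutral)
  then have "i mod m = r mod m" "(n - i) mod m = s mod m"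
    using assms by (auto simp: supported_def)
  then have "(i + (n - i)) mod m = (r + s) mod m" by (rule mod_add_cong)
  with i show "n mod m = (r + s) mod m" by simp
qed

lemma supported_power2: "supported m r f \<Longrightarrow> supported m (2 * r) (f\<^sup>2)"
  using supported_mult[of m r f r f] by (simp add: power2_eq_square mult_2)

lemma supported_numeral: "supported m 0 (numeral k)"
  by (auto simp: supported_def fps_numeral_nth)

lemma supported_numeral_mult: "supported m r f \<Longrightarrow> supported m r (numeral k * f)"
  using supported_mult[OF supported_numeral] by fastforce

lemma supported_dilate:
  assumes "0 < k" "supported m r f"
  shows "supported m (k * r) (dilate k f)"
  using assms by (auto simp: supported_def dilate_nth dvd_def split: if_splits)
    (metis mod_mult_right_eq)

lemma supported_dilate_self: "0 < k \<Longrightarrow> m dvd k \<Longrightarrow> supported m 0 (dilate k f)"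
  by (auto simp: supported_def dilate_nth split: if_splits)

lemma supported_theta:
  assumes "\<And>x. x \<in> S \<Longrightarrow> int m dvd f x - int r"
  shows "supported m r (theta f S)"
  unfolding supported_def
proof (intro allI impI)
  fix n assume "theta f S $ n \<noteq> 0"
  then obtain x where "x \<in> S" "f x = int n"
    by (auto simp: theta_nth card_eq_0_iff)
  then have "int m dvd int n - int r" using assms by metis
  then have "int n mod int m = int r mod int m" by (simp add: mod_eq_dvd_iff)
  then show "n mod m = r mod m" by (metis of_nat_eq_iff zmod_int)
qed

lemma c_series_supported: "supported 3 1 c_series"
  unfolding c_series_def
proof (rule supported_theta)
  fix z assume "z \<in> one_mod_3"
  then obtain k l where "z = (1 + 3 * k, 3 * l)"
    by (cases z) (auto simp: mem_eis_sets dvd_def, metis diff_add_cancel add.commute)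
  then have "eis_norm z - 1 = 3 * (2 * k + 3 * k * k - l - 3 * k * l + 3 * l * l)"
    by (simp add: power2_eq_square algebra_simps)
  then show "int 3 dvd eis_norm z - int 1" by simp
qed

lemma co_series_supported_3: "supported 3 1 co_series"
  unfolding co_series_def
proof (rule supported_theta)
  fix z assume z0: "z \<in> mod_\<theta> 1 \<inter> one_mod_2"
  obtain x y where z: "z = (x, y)" by (cases z)
  with z0 obtain k where "x + y - 1 = 3 * k" by (auto simp: mem_eis_sets dvd_def)
  then have "x = 1 + 3 * k - y" by simp
  with z have "eis_norm z - 1 = 3 * (2 * k + 3 * k * k - y - 3 * k * y + y * y)"
    by (simp add: power2_eq_square algebra_simps)
  then show "int 3 dvd eis_norm z - int 1" by simp
qed

lemma o_series_supported_2: "supported 2 1 o_series" and co_series_supported_2: "supported 2 1 co_series"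
  unfolding o_series_def co_series_def
  by (rule supported_theta; auto simp: one_mod_2_def)+

lemma numeral_mult_fps_eq_0: "numeral k * f = 0 \<Longrightarrow> f = 0" for f :: "int fps"
  by (simp add: fps_eq_iff numeral_fps_const)

text \<open>These are the parts of \<open>parallelogram\<close> with exponents congruent to 0, 2 and 1 modulo 3, once each
series has been split by residues modulo \<open>\<theta>\<close>. They are the only inputs of the descent below.\<close>
lemma dissect_parallelogram:
  "(dilate 6 a_series)\<^sup>2 = (dilate 12 a_series)\<^sup>2 + 3 * (dilate 3 o_series)\<^sup>2"
  "dilate 6 a_series * dilate 2 c_series = 3 * (dilate 4 c_series)\<^sup>2 + co_series\<^sup>2"
  "3 * (dilate 2 c_series)\<^sup>2 = dilate 12 a_series * dilate 4 c_series + dilate 3 o_series * co_series"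
proof -
  define a1 a2 o3 c1 c2 where defs: "a1 = dilate 6 a_series" "a2 = dilate 12 a_series"
    "o3 = dilate 3 o_series" "c1 = dilate 2 c_series" "c2 = dilate 4 c_series"
  have "dilate 3 ((dilate 2 a_series)\<^sup>2) = dilate 3 ((dilate 4 a_series)\<^sup>2 + 3 * o_series\<^sup>2)"
    by (simp only: parallelogram)
  then have 0: "a1\<^sup>2 = a2\<^sup>2 + 3 * o3\<^sup>2" by (simp add: dilate_simps defs)
  have "dilate 2 a_series = dilate 2 (dilate 3 a_series + 6 * c_series)"
    "dilate 4 a_series = dilate 4 (dilate 3 a_series + 6 * c_series)"
    by (simp_all only: a_series_mod_3[symmetric])
  then have *: "dilate 2 a_series = a1 + 6 * c1" "dilate 4 a_series = a2 + 6 * c2"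
    by (simp_all add: dilate_simps defs)
  have **: "o_series = o3 + 2 * co_series"
    unfolding defs by (rule o_series_mod_3)
  \<comment> \<open>the differences of the two sides in the classes 1 and 2\<close>
  let ?Z1 = "a2 * c2 + o3 * co_series - 3 * c1\<^sup>2" and ?Z2 = "3 * c2\<^sup>2 + co_series\<^sup>2 - a1 * c1"
  have "(a1 + 6 * c1)\<^sup>2 = (a2 + 6 * c2)\<^sup>2 + 3 * (o3 + 2 * co_series)\<^sup>2"
    using parallelogram unfolding * ** .
  then have "12 * (?Z1 + ?Z2) = a1\<^sup>2 - (a2\<^sup>2 + 3 * o3\<^sup>2)"
    by (simp add: power2_eq_square algebra_simps)
  also have "\<dots> = 0" using 0 by simp
  finally have sum: "?Z1 + ?Z2 = 0" by (rule numeral_mult_fps_eq_0)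
  have s: "supported 3 0 a1" "supported 3 0 a2" "supported 3 0 o3" "supported 3 2 c1" "supported 3 1 c2"
    "supported 3 1 co_series"
    unfolding defs using supported_dilate[OF _ c_series_supported, of 2]
      supported_dilate[OF _ c_series_supported, of 4, THEN supported_cong, of 1]
    by (auto intro: supported_dilate_self co_series_supported_3[simplified])
  have Z1: "supported 3 1 ?Z1"
    using supported_mult[OF s(2) s(5)] supported_mult[OF s(3) s(6)]
      supported_cong[OF supported_power2[OF s(4)], of 1]
    by (intro supported_add supported_diff supported_numeral_mult) simp_all
  have Z2: "supported 3 2 ?Z2"
    using supported_mult[OF s(1) s(4), THEN supported_cong, of 2] supported_power2[OF s(6)]
      supported_power2[OF s(5)]
    by (intro supported_add supported_diff supported_numeral_mult) simp_all
  have "?Z1 $ n = 0 \<and> ?Z2 $ n = 0" for n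
  proof -
    have "?Z1 $ n + ?Z2 $ n = 0" using sum by (metis fps_add_nth fps_zero_nth)
    moreover have "?Z1 $ n = 0 \<or> ?Z2 $ n = 0"
      using supported_nth[OF Z1, of n] supported_nth[OF Z2, of n] by force
    ultimately show ?thesis by linarith
  qed
  then have "?Z1 = 0" "?Z2 = 0" by (auto intro!: fps_ext simp only: fps_zero_nth)
  then show "(dilate 6 a_series)\<^sup>2 = (dilate 12 a_series)\<^sup>2 + 3 * (dilate 3 o_series)\<^sup>2"
    "dilate 6 a_series * dilate 2 c_series = 3 * (dilate 4 c_series)\<^sup>2 + co_series\<^sup>2"
    "3 * (dilate 2 c_series)\<^sup>2 = dilate 12 a_series * dilate 4 c_series + dilate 3 o_series * co_series"
    using 0 unfolding defs by simp_all
qed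

section \<open>The quadratic modular equations by descent\<close>
text \<open>Divisibility by \<open>t ^ k\<close>, which unlike a bound on the subdegree needs no exception for the zero series.\<close>
definition vanishes :: "nat \<Rightarrow> int fps \<Rightarrow> bool" where
  "vanishes k f \<longleftrightarrow> (\<forall>i<k. f $ i = 0)"

lemma vanishes_mono: "vanishes k f \<Longrightarrow> l \<le> k \<Longrightarrow> vanishes l f"
  by (simp add: vanishes_def)

lemma vanishes_add: "vanishes k f \<Longrightarrow> vanishes k g \<Longrightarrow> vanishes k (f + g)"
  by (simp add: vanishes_def)

lemma vanishes_diff: "vanishes k f \<Longrightarrow> vanishes k g \<Longrightarrow> vanishes k (f - g)"
  by (simp add: vanishes_def)

lemma vanishes_mult:
  assumes "vanishes k f" "vanishes l g"
  shows "vanishes (k + l) (f * g)"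
  unfolding vanishes_def fps_mult_nth
proof (intro allI impI sum.neutral ballI)
  fix n i assume "n < k + l" "i \<in> {0..n}"
  then have "i < k \<or> n - i < l" by auto
  then show "f $ i * g $ (n - i) = 0" using assms by (auto simp: vanishes_def)
qed

lemma vanishes_mult_left: "vanishes k f \<Longrightarrow> vanishes k (g * f)"
  using vanishes_mult[of 0 g k f] by (simp add: vanishes_def)

lemma vanishes_dilate:
  assumes "0 < m" "vanishes k f"
  shows "vanishes (m * k) (dilate m f)"
  using assms by (auto simp: vanishes_def dilate_nth elim!: dvdE)

lemma vanishes_cancel:
  assumes "vanishes v (f * g)" "g $ u \<noteq> 0"
  shows "vanishes (v - u) f"
proof (cases "f = 0")
  case False
  from assms(2) have g: "g \<noteq> 0" "subdegree g \<le> u" by (auto intro: subdegree_leI)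
  have "v \<le> subdegree (f * g)"
    using assms(1) False g by (intro subdegree_geI) (auto simp: vanishes_def)
  then have "v - u \<le> subdegree f" using False g by simp
  then show ?thesis
    unfolding vanishes_def using nth_less_subdegree_zero[of _ f] by (meson less_le_trans)
qed (simp add: vanishes_def)

text \<open>Positivity of the leading coefficient makes leading terms of sums of such series unable to cancel.\<close>
definition leads :: "nat \<Rightarrow> int fps \<Rightarrow> bool" where
  "leads k f \<longleftrightarrow> vanishes k f \<and> 0 < f $ k"

lemma leads_add: "leads k f \<Longrightarrow> leads k g \<Longrightarrow> leads k (f + g)"
  by (simp add: leads_def vanishes_add)

lemma leads_mult:
  assumes "leads k f" "leads l g"
  shows "leads (k + l) (f * g)"
proof -
  have "subdegree f = k" "subdegree g = l"
    using assms by (auto simp: leads_def vanishes_def intro: subdegreeI)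
  then show ?thesis
    using assms vanishes_mult nth_subdegree_mult[of f g] by (auto simp: leads_def)
qed

lemma leads_dilate: "0 < m \<Longrightarrow> leads k f \<Longrightarrow> leads (m * k) (dilate m f)"
  by (simp add: leads_def vanishes_dilate dilate_nth)

lemma leads_numeral: "leads 0 (numeral k)"
  by (simp add: leads_def vanishes_def)

lemma eis_norm_eq_0: "eis_norm z = 0 \<longleftrightarrow> z = (0, 0)"
proof
  assume *: "eis_norm z = 0"
  obtain x y where z: "z = (x, y)" by (cases z)
  have "x\<^sup>2 = 0" "y\<^sup>2 = 0"
    using * eis_norm_bounds(1)[of x y] eis_norm_bounds(2)[of y x] zero_le_power2[of x] zero_le_power2[of y]
    unfolding z by linarith+
  with z show "z = (0, 0)" by simp
qed simp

lemma theta_eis_norm_pos: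
  assumes "(1, 0) \<in> S"
  shows "0 < theta eis_norm S $ 1"
proof -
  have "finite {z\<in>S. eis_norm z = int 1}"
    using graded_eis_norm[of S] by (simp only: graded_def)
  moreover have "(1, 0) \<in> {z\<in>S. eis_norm z = int 1}" using assms by simp
  ultimately show ?thesis by (auto simp: theta_nth card_gt_0_iff simp del: eis_norm.simps)
qed

lemma leads_theta:
  assumes "(1, 0) \<in> S" "(0, 0) \<notin> S"
  shows "leads 1 (theta eis_norm S)"
proof -
  have "theta eis_norm S $ 0 = 0"
    using assms(2) by (auto simp: theta_nth eis_norm_eq_0 card_eq_0_iff simp del: eis_norm.simps)
  then show ?thesis
    using theta_eis_norm_pos[OF assms(1)] by (auto simp: leads_def vanishes_def)
qed

lemma leads_series: "leads 1 c_series" "leads 1 o_series" "leads 1 co_series"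
  unfolding c_series_def o_series_def co_series_def by (rule leads_theta; simp add: mem_eis_sets)+

lemma leads_a_diff: "leads 1 (a_series - dilate 2 a_series)"
  using theta_eis_norm_pos[of UNIV] by (auto simp: leads_def vanishes_def dilate_nth a_series_def)

text \<open>In terms of \<open>a = a(q)\<close>, \<open>A = a(q\<^sup>2)\<close>, \<open>c = c(q)\<close>, \<open>C = c(q\<^sup>2)\<close>, these identities are parts of the
modular equations \<open>2 C\<^sup>2 = c (a - A)\<close> and \<open>c\<^sup>2 = C (a + 2 A)\<close>: the first one with \<open>q\<^sup>2\<close> in place of
\<open>q\<close>, and the odd exponents of the second one. No change of variables in a lattice can prove
them, because the quaternary forms of their terms are not all equivalent over the rationals.

They hold by descent. The defect \<open>e0\<close> of the first equation is expressed, through the elementary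
relations, by \<open>dilate 4 e0\<close>, \<open>s\<close> and \<open>dilate 2 p\<close>, where each of \<open>s\<close> and \<open>p\<close> becomes a multiple of \<open>dilate 2 e0\<close> after multiplication by a series with known leading term. Dilation doubles the order of
vanishing, and this gain exceeds the loss from the leading terms as soon as \<open>e0\<close>
vanishes to order 4. So \<open>e0\<close> vanishes to every order.\<close>
lemma cubic_identities:
  "6 * (dilate 4 c_series)\<^sup>2 = dilate 2 c_series * (dilate 6 a_series - dilate 12 a_series)"
  "2 * dilate 4 c_series * co_series = dilate 3 o_series * dilate 2 c_series"
proof -
  define a0 a1 a2 a3 o3 where a: "a0 = dilate 3 a_series" "a1 = dilate 6 a_series"
    "a2 = dilate 12 a_series" "a3 = dilate 24 a_series" "o3 = dilate 3 o_series"
  define c0 c1 c2 c3 where c: "c0 = c_series" "c1 = dilate 2 c_series" "c2 = dilate 4 c_series"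
    "c3 = dilate 8 c_series"
  define X where X: "X = a1 - a2"
  define e0 e1 f0 f1 p s where e0: "e0 = 6 * c1\<^sup>2 - c0 * (a0 - a1)" and e1: "e1 = dilate 2 e0"
    and f0: "f0 = 3 * c0\<^sup>2 - c1 * (a0 + 2 * a1)" and f1: "f1 = dilate 2 f0"
    and p: "p = 2 * c2 * co_series - o3 * c1" and s: "s = 3 * o3 * c2 - co_series * X"
  note B = dissect_parallelogram[folded a c]
  have "dilate 3 a_series = dilate 3 (dilate 4 a_series + 3 * o_series)"
    by (simp only: a_series_mod_2[symmetric])
  then have A1: "a0 = a2 + 3 * o3" by (simp add: dilate_simps a)
  have A2: "c0 = c2 + co_series" unfolding c by (rule c_series_mod_2)
  have e1': "e1 = 6 * c2\<^sup>2 - c1 * X" and f1': "f1 = 3 * c1\<^sup>2 - c2 * (a1 + 2 * a2)"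
    by (simp_all add: e1 e0 f1 f0 a c X dilate_simps)
  \<comment> \<open>\<open>e1\<close> and \<open>p\<close> are, up to factors, the even and odd parts of \<open>f0\<close>; likewise \<open>f1\<close> and \<open>s\<close>
    for \<open>e0\<close>\<close>
  have f0': "f0 = 3 * p - e1"
    unfolding f0 p e1' X A1 A2 using B(2) by algebra
  have e0': "e0 = - f1 - s"
    unfolding f1' s e0 X A1 A2 using B(3) by algebra
  \<comment> \<open>multiplying an odd part by its conjugate leaves only squares, to which the elementary
    relations apply\<close>
  have s_eq: "s * (3 * o3 * c2 + co_series * X) = X * a1 * e1"
    unfolding s e1' X using B(1,2) by algebra
  have p_eq: "3 * p * (2 * c2 * co_series + o3 * c1) = (2 * c1 * a2 - e1) * e1"
    unfolding p e1' X using B(1,2) by algebra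
  have "f1 = dilate 2 (3 * p) - dilate 2 e1"
    unfolding f1 f0' by (rule dilate_diff)
  then have e0_rec: "e0 = dilate 2 e1 - dilate 2 (3 * p) - s" using e0' by simp
  have o3: "leads 3 o3" and c1: "leads 2 c1" and c2: "leads 4 c2"
    using leads_dilate[of 3, OF _ leads_series(2)] leads_dilate[OF _ leads_series(1), of 2]
      leads_dilate[OF _ leads_series(1), of 4]
    by (simp_all add: a c)
  have "X = dilate 6 (a_series - dilate 2 a_series)" by (simp add: X a dilate_simps)
  then have X6: "leads 6 X" using leads_dilate[of 6, OF _ leads_a_diff] by simp
  have U: "leads 7 (3 * o3 * c2 + co_series * X)"
    using leads_mult[OF leads_mult[OF leads_numeral[of "num.Bit1 num.One"] o3] c2]
      leads_mult[OF leads_series(3) X6]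
    by (intro leads_add) simp_all
  have V: "leads 5 (2 * c2 * co_series + o3 * c1)"
    using leads_mult[OF leads_mult[OF leads_numeral[of "num.Bit0 num.One"] c2] leads_series(3)]
      leads_mult[OF o3 c1]
    by (intro leads_add) simp_all
  \<comment> \<open>if \<open>e0\<close> vanishes to order \<open>k\<close>, then \<open>s\<close> vanishes to order \<open>6 + 2 * k - 7\<close>, and \<open>dilate 2 p\<close>
    to order \<open>2 * (2 + 2 * k - 5)\<close>; both exceed \<open>k\<close> from \<open>k = 3\<close> on\<close>
  have "vanishes (k + 4) e0" for k
  proof (induction k)
    case 0
    have "a0 - a1 = dilate 3 (a_series - dilate 2 a_series)" by (simp add: a dilate_simps)
    then have "leads 3 (a0 - a1)" using leads_dilate[of 3, OF _ leads_a_diff] by simp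
    moreover have "vanishes 4 (6 * c1\<^sup>2)"
      using vanishes_mult[of 2 c1 2 c1] c1
      by (intro vanishes_mult_left) (simp add: leads_def power2_eq_square)
    ultimately show ?case
      using vanishes_mult[of 1 c0 3 "a0 - a1"] leads_series(1)
      unfolding e0 c by (intro vanishes_diff) (auto simp: leads_def)
  next
    case (Suc k)
    have e1_v: "vanishes (2 * (k + 4)) e1"
      unfolding e1 by (rule vanishes_dilate[OF _ Suc]) simp
    have "vanishes (6 + 2 * (k + 4)) (X * a1 * e1)"
      using X6 unfolding mult.assoc leads_def
      by (intro vanishes_mult vanishes_mult_left[OF e1_v]) simp
    then have "vanishes (6 + 2 * (k + 4) - 7) s"
      using U by (intro vanishes_cancel[of _ s "3 * o3 * c2 + co_series * X"]) (auto simp: s_eq leads_def)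
    then have 1: "vanishes (Suc k + 4) s" by (rule vanishes_mono) simp
    have "vanishes 2 (2 * c1 * a2 - e1)"
      using c1 e1_v vanishes_mult_left[of 2 c1 "2 * a2"]
      by (intro vanishes_diff) (auto simp: leads_def mult_ac elim: vanishes_mono)
    then have "vanishes (2 + 2 * (k + 4)) ((2 * c1 * a2 - e1) * e1)"
      using e1_v by (rule vanishes_mult)
    then have "vanishes (2 + 2 * (k + 4) - 5) (3 * p)"
      using V by (intro vanishes_cancel[of _ "3 * p" "2 * c2 * co_series + o3 * c1"])
        (auto simp: p_eq leads_def)
    then have "vanishes (2 * (2 + 2 * (k + 4) - 5)) (dilate 2 (3 * p))"
      by (rule vanishes_dilate[rotated]) simp
    then have 2: "vanishes (Suc k + 4) (dilate 2 (3 * p))" by (rule vanishes_mono) simp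
    have "vanishes (2 * (2 * (k + 4))) (dilate 2 e1)"
      by (rule vanishes_dilate[OF _ e1_v]) simp
    then have 3: "vanishes (Suc k + 4) (dilate 2 e1)" by (rule vanishes_mono) simp
    show ?case
      by (subst e0_rec) (intro vanishes_diff 1 2 3)
  qed
  then have "e0 $ n = 0" for n
    by (simp add: vanishes_def) (metis add.commute less_add_same_cancel1 trans_less_add1 zero_less_numeral)
  then have "e0 = 0" by (simp add: fps_eq_iff)
  then have e10: "e1 = 0" by (simp add: e1 dilate_def)
  then show "6 * (dilate 4 c_series)\<^sup>2 = dilate 2 c_series * (dilate 6 a_series - dilate 12 a_series)"
    using e1' by (simp add: X a c)
  have "2 * c2 * co_series + o3 * c1 \<noteq> 0" using V fps_nonzeroI unfolding leads_def by (metis less_irrefl)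
  moreover have "3 * p * (2 * c2 * co_series + o3 * c1) = 0" using p_eq e10 by simp
  ultimately have "3 * p = 0" by (metis mult_eq_0_iff)
  then have "p = 0" by (rule numeral_mult_fps_eq_0)
  then show "2 * dilate 4 c_series * co_series = dilate 3 o_series * dilate 2 c_series"
    by (simp add: p a c)
qed

section \<open>Partitions with 3-cores as Eisenstein integers\<close>
text \<open>The first-column hook numbers of the partition. Sliding a bead of this set down by \<open>t\<close> to an empty
place corresponds to a hook number equal to \<open>t\<close>, which turns the core condition into a closure
property.\<close>
fun beta_set :: "nat list \<Rightarrow> nat set" where
  "beta_set [] = {}"
| "beta_set (p # ps) = insert (p + length ps) (beta_set ps)"

lemma finite_beta_set: "finite (beta_set ps)"
  by (induction ps) auto

lemma is_partition_Cons:
  "is_partition (p # ps) \<longleftrightarrow> 0 < p \<and> (\<forall>q\<in>set ps. q \<le> p) \<and> is_partition ps"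
  by (auto simp: is_partition_def)

lemma beta_set_less:
  assumes "is_partition ps" "\<And>q. q \<in> set ps \<Longrightarrow> q \<le> p" "b \<in> beta_set ps"
  shows "b < p + length ps"
  using assms
proof (induction ps arbitrary: p)
  case (Cons q ps)
  then have "b \<le> q + length ps" by (fastforce simp: is_partition_Cons)
  also have "\<dots> < p + length (q # ps)" using Cons.prems(2)[of q] by simp
  finally show ?case .
qed simp

lemma zero_notin_beta_set: "is_partition ps \<Longrightarrow> 0 \<notin> beta_set ps"
  by (induction ps) (auto simp: is_partition_Cons)

lemma card_beta_set: "is_partition ps \<Longrightarrow> card (beta_set ps) = length ps"
proof (induction ps)
  case (Cons p ps)
  then have "p + length ps \<notin> beta_set ps" using beta_set_less[of ps p] by (auto simp: is_partition_Cons)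
  with Cons show ?case by (simp add: finite_beta_set is_partition_Cons)
qed simp

lemma sum_beta_set: "is_partition ps \<Longrightarrow> \<Sum>(beta_set ps) = sum_list ps + \<Sum>{..<length ps}"
proof (induction ps)
  case (Cons p ps)
  then have "p + length ps \<notin> beta_set ps" using beta_set_less[of ps p] by (auto simp: is_partition_Cons)
  with Cons show ?case by (simp add: finite_beta_set is_partition_Cons)
qed simp

text \<open>Number the steps of the boundary of the Young diagram from 0, starting at the bottom left corner. The
vertical steps, one for each row, have the numbers in \<open>beta_set ps\<close>. The horizontal step of column \<open>j\<close>
comes after \<open>j\<close> horizontal steps and after the vertical steps of the rows of length at most \<open>j\<close>.\<close>
lemma notin_beta_set_iff:
  assumes "is_partition ps"
  shows "c \<notin> beta_set ps \<longleftrightarrow> (\<exists>j. c = j + length (filter (\<lambda>x. x \<le> j) ps))"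
  using assms
proof (induction ps arbitrary: c)
  case (Cons p ps)
  let ?g = "\<lambda>j. j + length (filter (\<lambda>x. x \<le> j) ps)"
  let ?g' = "\<lambda>j. j + length (filter (\<lambda>x. x \<le> j) (p # ps))"
  from Cons.prems have ps: "is_partition ps" and le: "\<And>q. q \<in> set ps \<Longrightarrow> q \<le> p"
    by (auto simp: is_partition_Cons)
  \<comment> \<open>a new top row moves the numbers of the columns beyond it up by one, which frees exactly the
    place \<open>p + length ps\<close>\<close>
  have lt: "?g' j = ?g j \<and> ?g j < p + length ps" if "j < p" for j
    using that length_filter_le[of "\<lambda>x. x \<le> j" ps] by (simp add: add_less_le_mono)
  have ge: "?g j = j + length ps \<and> ?g' j = Suc (j + length ps)" if "p \<le> j" for j
  proof -
    have "filter (\<lambda>x. x \<le> j) ps = ps" using le that by (fastforce simp: filter_id_conv)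
    with that show ?thesis by simp
  qed
  have "(\<exists>j. c = ?g' j) \<longleftrightarrow> c \<noteq> p + length ps \<and> (\<exists>j. c = ?g j)"
  proof (intro iffI conjI)
    assume "\<exists>j. c = ?g' j"
    then obtain j where j: "c = ?g' j" ..
    show "c \<noteq> p + length ps" "\<exists>j. c = ?g j"
    proof -
      show "c \<noteq> p + length ps" using j lt[of j] ge[of j] by (cases "j < p") simp_all
      show "\<exists>j. c = ?g j"
      proof (cases "j < p")
        case True
        with j lt[of j] show ?thesis by metis
      next
        case False
        with j ge[of j] ge[of "Suc j"] have "c = ?g (Suc j)" by simp
        then show ?thesis ..
      qed
    qed
  next
    assume *: "c \<noteq> p + length ps \<and> (\<exists>j. c = ?g j)"
    then obtain j where j: "c = ?g j" by blast
    show "\<exists>j. c = ?g' j"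
    proof (cases "j < p")
      case True
      with j lt[of j] show ?thesis by metis
    next
      case False
      with j * ge[of j] have "j \<noteq> p" by auto
      with False obtain i where "j = Suc i" "p \<le> i" by (cases j) auto
      with j ge[of j] ge[of i] have "c = ?g' i" by simp
      then show ?thesis ..
    qed
  qed
  with Cons.IH[OF ps, of c] show ?case by auto
qed simp

lemma hook_number_first_row:
  assumes "j < p"
  shows "hook_number (p # ps) (0, j) = p - j + length (filter (\<lambda>x. j < x) ps)"
proof -
  have "hook (p # ps) (0, j) = Pair 0 ` {j..<p} \<union> (\<lambda>k. (Suc k, j)) ` {k. k < length ps \<and> j < ps ! k}"
    using assms by (auto simp: hook_def young_diagram_def nth_Cons split: nat.splits)
  moreover have "card (Pair (0 :: nat) ` {j..<p}) = p - j"
    by (simp add: card_image inj_on_def)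
  moreover have "card ((\<lambda>k. (Suc k, j)) ` {k. k < length ps \<and> j < ps ! k}) = length (filter (\<lambda>x. j < x) ps)"
    by (simp add: card_image inj_on_def length_filter_conv_card)
  ultimately show ?thesis
    unfolding hook_number_def by (simp add: card_Un_disjoint disjoint_iff image_iff)
qed

lemma hook_number_Cons: "hook_number (p # ps) (Suc i, j) = hook_number ps (i, j)"
proof -
  have "hook (p # ps) (Suc i, j) = (\<lambda>(k, l). (Suc k, l)) ` hook ps (i, j)"
  proof (intro equalityI subsetI)
    fix z assume "z \<in> hook (p # ps) (Suc i, j)"
    moreover obtain k l where z: "z = (k, l)" by (cases z)
    ultimately obtain k' where "k = Suc k'" "(k', l) \<in> hook ps (i, j)"
      by (cases k) (auto simp: hook_def young_diagram_def)
    with z show "z \<in> (\<lambda>(k, l). (Suc k, l)) ` hook ps (i, j)" by force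
  qed (auto simp: hook_def young_diagram_def)
  then show ?thesis
    unfolding hook_number_def by (simp add: card_image inj_on_def case_prod_beta prod_eq_iff)
qed

lemma is_core_Cons:
  "is_core t (p # ps) \<longleftrightarrow> is_partition (p # ps) \<and> is_core t ps \<and> (\<forall>j<p. \<not> t dvd hook_number (p # ps) (0, j))"
proof -
  have "young_diagram (p # ps) = Pair 0 ` {..<p} \<union> (\<lambda>(i, j). (Suc i, j)) ` young_diagram ps"
  proof (intro equalityI subsetI)
    fix z assume "z \<in> young_diagram (p # ps)"
    then show "z \<in> Pair 0 ` {..<p} \<union> (\<lambda>(i, j). (Suc i, j)) ` young_diagram ps"
      by (cases z; cases "fst z") (force simp: young_diagram_def)+
  qed (auto simp: young_diagram_def)
  then show ?thesis
    unfolding is_core_def by (auto simp: hook_number_Cons ball_Un is_partition_Cons)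
qed

text \<open>The hook numbers of the row with element \<open>b\<close> are the differences \<open>b - c\<close> with \<open>c\<close> a missing number
below \<open>b\<close>. The rows below the first one keep their hooks when it is removed, so the
first row is the only new case in an induction.\<close>
lemma is_core_iff_beta_set_differences:
  "is_core t ps \<longleftrightarrow> is_partition ps \<and> (\<forall>b\<in>beta_set ps. \<forall>c<b. c \<notin> beta_set ps \<longrightarrow> \<not> t dvd b - c)"
proof (induction ps)
  case Nil
  then show ?case by (simp add: is_core_def young_diagram_def)
next
  case (Cons p ps)
  show ?case
  proof (cases "is_partition (p # ps)")
    case True
    then have ps: "is_partition ps" and le: "\<And>q. q \<in> set ps \<Longrightarrow> q \<le> p"
      by (auto simp: is_partition_Cons)
    let ?b = "p + length ps"
    let ?g = "\<lambda>j. j + length (filter (\<lambda>x. x \<le> j) ps)"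
    have less: "b < ?b" if "b \<in> beta_set ps" for b
      using beta_set_less[OF ps le that] .
    have g: "?g j < ?b \<and> ?b - ?g j = hook_number (p # ps) (0, j)" if "j < p" for j
    proof -
      have "length (filter (\<lambda>x. x \<le> j) ps) + length (filter (\<lambda>x. j < x) ps) = length ps"
        using sum_length_filter_compl[of "\<lambda>x. x \<le> j" ps] by (simp add: not_le)
      with that show ?thesis by (simp add: hook_number_first_row)
    qed
    have ge: "?b \<le> ?g j" if "p \<le> j" for j
    proof -
      have "filter (\<lambda>x. x \<le> j) ps = ps" using le that by (fastforce simp: filter_id_conv)
      with that show ?thesis by simp
    qed
    have "(\<forall>c<?b. c \<notin> beta_set ps \<longrightarrow> \<not> t dvd ?b - c) \<longleftrightarrow> (\<forall>j<p. \<not> t dvd hook_number (p # ps) (0, j))"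
      unfolding notin_beta_set_iff[OF ps] using g ge by (metis not_le)
    moreover have "(\<forall>b\<in>beta_set (p # ps). \<forall>c<b. c \<notin> beta_set (p # ps) \<longrightarrow> \<not> t dvd b - c) \<longleftrightarrow>
      (\<forall>c<?b. c \<notin> beta_set ps \<longrightarrow> \<not> t dvd ?b - c) \<and>
      (\<forall>b\<in>beta_set ps. \<forall>c<b. c \<notin> beta_set ps \<longrightarrow> \<not> t dvd b - c)"
      using less by auto (metis less_asym' less_trans nat_neq_iff)+
    ultimately show ?thesis
      using Cons.IH ps True by (simp only: is_core_Cons) blast
  qed (simp add: is_core_def)
qed

lemma differences_iff_closed:
  assumes "0 < (t :: nat)"
  shows "(\<forall>b\<in>X. \<forall>c<b. c \<notin> X \<longrightarrow> \<not> t dvd b - c) \<longleftrightarrow> (\<forall>b\<in>X. t \<le> b \<longrightarrow> b - t \<in> X)"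
proof (intro iffI ballI allI impI)
  fix b assume "\<forall>b\<in>X. \<forall>c<b. c \<notin> X \<longrightarrow> \<not> t dvd b - c" "b \<in> X" "t \<le> b"
  then show "b - t \<in> X" using assms
    by (metis add_diff_cancel_left' diff_less dvd_refl le_add_diff_inverse2 less_le_trans)
next
  fix b c assume closed: "\<forall>b\<in>X. t \<le> b \<longrightarrow> b - t \<in> X" and b: "b \<in> X" "c < b" "c \<notin> X"
  show "\<not> t dvd b - c"
  proof
    assume "t dvd b - c"
    then obtain k where "b - c = t * k" ..
    then have k: "b = c + t * k" using b by simp
    have "c + t * k \<in> X \<Longrightarrow> c \<in> X" for k
    proof (induction k)
      case (Suc k)
      then have "c + t * Suc k - t \<in> X" using closed by (metis le_add2 mult_Suc_right trans_le_add2 add.left_commute le_add1)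
      then show ?case using Suc.IH by simp
    qed simp
    with b k show False by blast
  qed
qed

lemma beta_set_inj:
  assumes "is_partition ps" "is_partition qs" "beta_set ps = beta_set qs"
  shows "ps = qs"
  using assms
proof (induction ps arbitrary: qs)
  case Nil
  then show ?case by (cases qs) auto
next
  case (Cons p ps)
  then obtain q qs' where qs: "qs = q # qs'" by (cases qs) auto
  have p: "b < p + length ps" if "b \<in> beta_set ps" for b
    using beta_set_less[of ps p b] Cons.prems(1) that by (auto simp: is_partition_Cons)
  have q: "b < q + length qs'" if "b \<in> beta_set qs'" for b
    using beta_set_less[of qs' q b] Cons.prems(2) that by (auto simp: is_partition_Cons qs)
  have eq: "insert (p + length ps) (beta_set ps) = insert (q + length qs') (beta_set qs')"
    using Cons.prems(3) qs by simp
  then have top: "p + length ps = q + length qs'"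
    using p q by (metis insert_iff less_asym)
  have "beta_set ps = beta_set qs'"
    using eq top p q by (metis insert_ident less_irrefl)
  then have "ps = qs'"
    using Cons.IH Cons.prems qs by (simp add: is_partition_Cons)
  with top qs show ?case by simp
qed

lemma beta_set_surj:
  assumes "finite X" "0 \<notin> X"
  shows "\<exists>ps. is_partition ps \<and> beta_set ps = X"
  using assms
proof (induction X rule: finite_linorder_max_induct)
  case empty
  have "is_partition []" by (simp add: is_partition_def)
  then show ?case by force
next
  case (insert b A)
  then obtain ps where ps: "is_partition ps" "beta_set ps = A" by auto
  have "is_partition ((b - length ps) # ps) \<and> length ps < b"
  proof (cases ps)
    case Nil
    with insert.prems show ?thesis by (simp add: is_partition_def)
  next
    case (Cons q qs)
    with ps insert.hyps have "q + length qs < b" by auto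
    then have "q + length ps \<le> b" using Cons by simp
    moreover have "0 < q" "\<forall>x\<in>set ps. x \<le> q" using ps(1) Cons by (auto simp: is_partition_Cons)
    ultimately show ?thesis using ps(1) by (fastforce simp: is_partition_Cons)
  qed
  with ps have "is_partition ((b - length ps) # ps) \<and> beta_set ((b - length ps) # ps) = insert b A"
    by simp
  then show ?case by blast
qed

text \<open>The sets of first-column hook numbers of 3-cores; \<open>0\<close> is excluded because parts are positive.\<close>
definition beta_closed :: "nat set set" where
  "beta_closed = {X. finite X \<and> 0 \<notin> X \<and> (\<forall>b\<in>X. 3 \<le> b \<longrightarrow> b - 3 \<in> X)}"

text \<open>On the runners 1 and 2 of an abacus with three runners, closed sets consist of the lowest beads, and
runner 0 is empty because it does not contain \<open>0\<close>.\<close>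
definition abacus :: "nat \<times> nat \<Rightarrow> nat set" where
  "abacus = (\<lambda>(m, n). (\<lambda>i. 3 * i + 1) ` {..<m} \<union> (\<lambda>i. 3 * i + 2) ` {..<n})"

lemma mem_abacus:
  "3 * i + 1 \<in> abacus (m, n) \<longleftrightarrow> i < m" "3 * i + 2 \<in> abacus (m, n) \<longleftrightarrow> i < n" "3 * i \<notin> abacus (m, n)"
  by (auto simp: abacus_def) presburger+

lemma nat_mod_3_cases:
  fixes b :: nat
  obtains i where "b = 3 * i" | i where "b = 3 * i + 1" | i where "b = 3 * i + 2"
proof -
  have "b = 3 * (b div 3) \<or> b = 3 * (b div 3) + 1 \<or> b = 3 * (b div 3) + 2" by presburger
  then show ?thesis using that by blast
qed

lemma down_closed_nat_eq_lessThan: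
  assumes "finite (A :: nat set)" "\<And>i. Suc i \<in> A \<Longrightarrow> i \<in> A"
  shows "\<exists>m. A = {..<m}"
proof -
  obtain m where m: "m \<notin> A" "\<And>i. i < m \<Longrightarrow> i \<in> A"
    using exists_least_iff[of "\<lambda>i. i \<notin> A"] ex_new_if_finite[OF infinite_UNIV_nat assms(1)] by auto
  have "m + k \<notin> A" for k
    by (induction k) (use m(1) assms(2) in auto)
  then have "A = {..<m}" using m(2) by (auto, metis le_Suc_ex not_le)
  then show ?thesis ..
qed

lemma bij_betw_abacus:
  "bij_betw abacus UNIV beta_closed"
  unfolding bij_betw_def
proof (intro conjI equalityI subsetI)
  show "inj abacus"
  proof (rule injI, clarify)
    fix m n m' n' assume "abacus (m, n) = abacus (m', n')"
    then have "i < m \<longleftrightarrow> i < m'" "i < n \<longleftrightarrow> i < n'" for i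
      using mem_abacus by metis+
    then show "m = m' \<and> n = n'" by (meson linorder_neq_iff less_irrefl)
  qed
next
  fix X assume "X \<in> range abacus"
  then obtain m n where X: "X = abacus (m, n)" by auto
  show "X \<in> beta_closed"
  proof -
    have "b - 3 \<in> X" if "b \<in> X" "3 \<le> b" for b
    proof (cases b rule: nat_mod_3_cases)
      case (1 i)
      with that(1) show ?thesis by (simp add: X mem_abacus)
    next
      case (2 i)
      with that(2) have "b - 3 = 3 * (i - 1) + 1" by simp
      with 2 that(1) show ?thesis unfolding X by (simp only: mem_abacus)
    next
      case (3 i)
      with that(2) have "b - 3 = 3 * (i - 1) + 2" by simp
      with 3 that(1) show ?thesis unfolding X by (simp only: mem_abacus)
    qed
    moreover have "finite X" by (simp add: X abacus_def)
    moreover have "0 \<notin> X" using mem_abacus(3)[of 0] by (simp add: X)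
    ultimately show ?thesis by (simp add: beta_closed_def)
  qed
next
  fix X :: "nat set" assume "X \<in> beta_closed"
  then have fin: "finite X" and 0: "0 \<notin> X" and closed: "\<And>b. b + 3 \<in> X \<Longrightarrow> b \<in> X"
    by (auto simp: beta_closed_def)
  have "\<exists>m. {i. 3 * i + r \<in> X} = {..<m}" for r
  proof (rule down_closed_nat_eq_lessThan)
    have "(\<lambda>i. 3 * i + r) ` {i. 3 * i + r \<in> X} \<subseteq> X" by auto
    then show "finite {i. 3 * i + r \<in> X}"
      by (rule inj_on_finite[rotated]) (auto simp: inj_on_def fin)
    show "i \<in> {i. 3 * i + r \<in> X}" if "Suc i \<in> {i. 3 * i + r \<in> X}" for i
      using that closed[of "3 * i + r"] by (simp add: algebra_simps)
  qed
  then obtain m n where mn: "\<And>i. 3 * i + 1 \<in> X \<longleftrightarrow> i < m" "\<And>i. 3 * i + 2 \<in> X \<longleftrightarrow> i < n"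
    by (metis lessThan_iff mem_Collect_eq)
  have not0: "3 * i \<notin> X" for i
    by (induction i) (use 0 closed in \<open>auto simp: algebra_simps\<close>)
  have "b \<in> X \<longleftrightarrow> b \<in> abacus (m, n)" for b
    by (cases b rule: nat_mod_3_cases) (simp_all only: mn not0 mem_abacus)
  then have "X = abacus (m, n)" by blast
  then show "X \<in> range abacus" by blast
qed

lemma card_abacus: "card (abacus (m, n)) = m + n"
proof -
  have "card ((\<lambda>i :: nat. 3 * i + 1) ` {..<m}) = m" "card ((\<lambda>i :: nat. 3 * i + 2) ` {..<n}) = n"
    by (simp_all add: card_image inj_on_def)
  moreover have "(\<lambda>i :: nat. 3 * i + 1) ` {..<m} \<inter> (\<lambda>i. 3 * i + 2) ` {..<n} = {}"
    by (auto; presburger)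
  ultimately show ?thesis by (simp add: abacus_def card_Un_disjoint)
qed

lemma sum_abacus: "\<Sum>(abacus (m, n)) = (\<Sum>i<m. 3 * i + 1) + (\<Sum>i<n. 3 * i + 2)"
proof -
  have "\<Sum>((\<lambda>i :: nat. 3 * i + 1) ` {..<m}) = (\<Sum>i<m. 3 * i + 1)"
    "\<Sum>((\<lambda>i :: nat. 3 * i + 2) ` {..<n}) = (\<Sum>i<n. 3 * i + 2)"
    by (simp_all add: sum.reindex inj_on_def)
  moreover have "(\<lambda>i :: nat. 3 * i + 1) ` {..<m} \<inter> (\<lambda>i. 3 * i + 2) ` {..<n} = {}"
    by (auto; presburger)
  ultimately show ?thesis by (simp add: abacus_def sum.union_disjoint)
qed

lemma bij_betw_beta_set:
  "bij_betw beta_set {ps. is_core 3 ps} beta_closed"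
proof -
  have core: "is_core 3 ps \<longleftrightarrow> is_partition ps \<and> (\<forall>b\<in>beta_set ps. 3 \<le> b \<longrightarrow> b - 3 \<in> beta_set ps)" for ps
    using is_core_iff_beta_set_differences[of 3 ps] differences_iff_closed[of 3 "beta_set ps"] by simp
  show ?thesis
    unfolding bij_betw_def
  proof (intro conjI equalityI subsetI)
    show "inj_on beta_set {ps. is_core 3 ps}"
      using beta_set_inj by (auto simp: inj_on_def core)
  next
    fix X assume "X \<in> beta_closed"
    then show "X \<in> beta_set ` {ps. is_core 3 ps}"
      using beta_set_surj[of X] by (auto simp: core image_iff beta_closed_def)
  qed (auto simp: core finite_beta_set zero_notin_beta_set beta_closed_def)
qed

definition core_weight :: "nat list \<Rightarrow> int" where
  "core_weight ps = 3 * int (sum_list ps) + 1"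

text \<open>A sector with angle of 120 degrees in the residue class 1 modulo \<open>\<theta>\<close>: the cone of pairs of natural
numbers, under the map \<open>(m, n) \<mapsto> 1 - \<theta> m - \<omega> \<theta> n\<close>.\<close>
definition sector :: "eisenstein set" where
  "sector = {(x, y). 3 dvd x + y - 1 \<and> 0 < x - 2 * y \<and> 0 < 2 * x - y}"

text \<open>A 3-core with \<open>m\<close> and \<open>n\<close> beads on its runners has size \<open>m\<^sup>2 - m n + n\<^sup>2 + n\<close>, by Gauss summation. Three
times this form plus 1 is the norm of the point of the sector that belongs to \<open>(m, n)\<close>.\<close>
lemma ex_bij_betw_cores_sector:
  "\<exists>h. bij_betw h {ps. is_core 3 ps} sector \<and> (\<forall>ps. is_core 3 ps \<longrightarrow> eis_norm (h ps) = core_weight ps)"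
proof -
  define g where "g = (\<lambda>(m, n). (1 - int m + 2 * int n, int n - 2 * int m))"
  define h where "h = g \<circ> inv_into UNIV abacus \<circ> beta_set"
  have "bij_betw g UNIV sector"
    unfolding bij_betw_def
  proof (intro conjI equalityI subsetI)
    fix z assume "z \<in> sector"
    then obtain x y k where z: "z = (x, y)" "x + y - 1 = 3 * k" "0 < x - 2 * y" "0 < 2 * x - y"
      by (auto simp: sector_def dvd_def)
    then have "0 \<le> k - y" "0 \<le> 2 * k - y" by linarith+
    then have "z = g (nat (k - y), nat (2 * k - y))" using z by (simp add: g_def)
    then show "z \<in> range g" by blast
  qed (auto simp: g_def sector_def inj_on_def)
  moreover have "bij_betw (inv_into UNIV abacus) beta_closed UNIV"
    by (rule bij_betw_inv_into[OF bij_betw_abacus])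
  ultimately have "bij_betw h {ps. is_core 3 ps} sector"
    unfolding h_def using bij_betw_beta_set by (metis bij_betw_trans)
  moreover have "eis_norm (h ps) = core_weight ps" if "is_core 3 ps" for ps
  proof -
    have ps: "is_partition ps" using that by (simp add: is_core_def)
    have "beta_set ps \<in> beta_closed" using bij_betw_beta_set that by (auto simp: bij_betw_def)
    then obtain m n where mn: "beta_set ps = abacus (m, n)"
      using bij_betw_abacus unfolding bij_betw_def by (metis image_iff surj_pair)
    have inv: "inv_into UNIV abacus (abacus (m, n)) = (m, n)"
      using bij_betw_abacus by (simp add: bij_betw_def)
    have len: "length ps = m + n"
      using card_beta_set[OF ps] mn card_abacus by simp
    have "sum_list ps + \<Sum>{..<m + n} = (\<Sum>i<m. 3 * i + 1) + (\<Sum>i<n. 3 * i + 2)"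
      using sum_beta_set[OF ps] mn sum_abacus len by simp
    then have "2 * int (sum_list ps) + 2 * int (\<Sum>{..<m + n}) = 2 * int (\<Sum>i<m. 3 * i + 1) + 2 * int (\<Sum>i<n. 3 * i + 2)"
      by presburger
    moreover have "2 * int (\<Sum>{..<k}) = int k * (int k - 1)" for k
      by (induction k) (simp_all add: algebra_simps)
    moreover have "2 * int (\<Sum>i<k. 3 * i + 1) = int k * (3 * int k - 1)" for k
      by (induction k) (simp_all add: algebra_simps)
    moreover have "2 * int (\<Sum>i<k. 3 * i + 2) = int k * (3 * int k + 1)" for k
      by (induction k) (simp_all add: algebra_simps)
    ultimately have "2 * int (sum_list ps) + int (m + n) * (int (m + n) - 1) =
        int m * (3 * int m - 1) + int n * (3 * int n + 1)" by metis
    then have "2 * int (sum_list ps) = 2 * ((int m)\<^sup>2 - int m * int n + (int n)\<^sup>2 + int n)"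
      by (simp add: power2_eq_square algebra_simps)
    then show ?thesis
      by (simp add: h_def mn inv g_def core_weight_def power2_eq_square algebra_simps)
  qed
  ultimately show ?thesis by blast
qed

text \<open>Three rotated copies of the sector tile the plane, and no element of \<open>mod_\<theta> 1\<close> lies on a boundary ray,
since the three linear forms that define these rays do not vanish modulo 3 on it.\<close>
lemma theta_sector: "theta eis_norm (mod_\<theta> 1) = 3 * theta eis_norm sector"
  by (rule theta_mult_\<omega>) (unfold sector_def eis_mem mem_Collect_eq prod.case, presburger+)

lemma theta_cores: "theta core_weight {ps. is_core 3 ps} = c_series"
  and graded_cores: "graded core_weight {ps. is_core 3 ps}"
proof -
  obtain h where h: "bij_betw h {ps. is_core 3 ps} sector"
    "\<And>ps. is_core 3 ps \<Longrightarrow> eis_norm (h ps) = core_weight ps"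
    using ex_bij_betw_cores_sector by blast
  have "theta core_weight {ps. is_core 3 ps} = theta eis_norm sector"
    by (rule theta_reindex[OF h(1)]) (simp add: h(2))
  moreover have "theta eis_norm sector - c_series = 0"
  proof (rule numeral_mult_fps_eq_0[where k = "num.Bit1 num.One"])
    show "3 * (theta eis_norm sector - c_series) = 0"
      using theta_sector theta_mod_\<theta>_1 by (simp add: algebra_simps)
  qed
  ultimately show "theta core_weight {ps. is_core 3 ps} = c_series" by simp
  have "finite {ps \<in> {ps. is_core 3 ps}. core_weight ps = n}" for n
  proof (rule inj_on_finite)
    show "inj_on h {ps \<in> {ps. is_core 3 ps}. core_weight ps = n}"
      using h(1) by (auto simp: bij_betw_def inj_on_def)
    show "h ` {ps \<in> {ps. is_core 3 ps}. core_weight ps = n} \<subseteq> {z\<in>UNIV. eis_norm z = n}"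
      using h(2) by auto
    show "finite {z\<in>UNIV. eis_norm z = n}"
      using graded_eis_norm[of UNIV] by (simp only: graded_def)
  qed
  then show "graded core_weight {ps. is_core 3 ps}"
    by (simp add: graded_def core_weight_def)
qed

lemma B3_eq_coeff: "int (B3 m) = (c_series * (c_series * c_series)) $ (3 * m + 3)"
proof -
  let ?C = "{ps. is_core 3 ps}"
  have "c_series * (c_series * c_series) =
      theta (\<lambda>(x, y). core_weight x + (case y of (x, y) \<Rightarrow> core_weight x + core_weight y)) (?C \<times> (?C \<times> ?C))"
    unfolding theta_cores[symmetric]
    by (simp only: theta_times graded_cores graded_times)
  moreover have "{p \<in> ?C \<times> (?C \<times> ?C).
      (\<lambda>(x, y). core_weight x + (case y of (x, y) \<Rightarrow> core_weight x + core_weight y)) p = int (3 * m + 3)} = B3_triples m"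
    by (auto simp: B3_triples_def core_weight_def)
  ultimately show ?thesis by (simp add: theta_nth B3_def)
qed

lemma theta_mod_\<theta>_minus_1: "theta eis_norm (mod_\<theta> (- 1)) = 3 * c_series"
  using theta_mod_\<theta>_minus[of UNIV] by (simp add: theta_mod_\<theta>_1)

section \<open>Triples of Eisenstein integers and the discrete Fourier transform\<close>
abbreviation "core_sum \<equiv> \<lambda>(z1, z2, z3). eis_norm z1 + (eis_norm z2 + eis_norm z3)"
abbreviation "dual_sum \<equiv> \<lambda>(u, v, w). 3 * eis_norm u + (eis_norm v + eis_norm w)"

text \<open>The matrix with rows \<open>(1, 1, 1)\<close>, \<open>(1, \<omega>\<^sup>2, \<omega>)\<close>, \<open>(1, \<omega>, \<omega>\<^sup>2)\<close>, applied to \<open>(\<theta> u, v, w)\<close>. It is unitary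
up to a factor, and therefore multiplies the sum of norms by 3.\<close>
fun dft :: "eisenstein \<times> eisenstein \<times> eisenstein \<Rightarrow> eisenstein \<times> eisenstein \<times> eisenstein" where
  "dft ((a, b), (c, d), (e, f)) =
    ((a - 2 * b + c + e, 2 * a - b + d + f),
     (a - 2 * b + d - c - f, 2 * a - b - c + e - f),
     (a - 2 * b - d + f - e, 2 * a - b + c - d - e))"

text \<open>The other two entries of the transform need no condition, since all three entries are congruent modulo
3 when \<open>v\<close> and \<open>w\<close> are congruent modulo \<open>\<theta>\<close>.\<close>
definition dual_triples :: "(eisenstein \<times> eisenstein \<times> eisenstein) set" where
  "dual_triples = {(u, v, w). v \<in> mod_\<theta> (- 1) \<and> w \<in> mod_\<theta> (- 1) \<and> fst (dft (u, v, w)) \<in> one_mod_3}"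

lemma core_sum_dft: "core_sum (dft p) = 3 * dual_sum p"
  by (cases p rule: dft.cases) (simp add: power2_eq_square algebra_simps)

lemma inj_dft: "inj_on dft S"
proof (rule inj_onI)
  fix p q assume "dft p = dft q"
  then show "p = q"
    by (cases p rule: dft.cases; cases q rule: dft.cases) simp
qed

lemma dft_mem:
  assumes "p \<in> dual_triples"
  shows "dft p \<in> one_mod_3 \<times> one_mod_3 \<times> one_mod_3"
proof -
  obtain a b c d e f where p: "p = ((a, b), (c, d), (e, f))" by (cases p rule: dft.cases)
  from assms obtain k l m n where
    "c + d + 1 = 3 * k" "e + f + 1 = 3 * l" "a - 2 * b + c + e - 1 = 3 * m" "2 * a - b + d + f = 3 * n"
    by (auto simp: p dual_triples_def mem_eis_sets dvd_def)
  then have "a - 2 * b + d - c - f - 1 = 3 * (m + k - l - c)" "2 * a - b - c + e - f = 3 * (n - k + l - f)"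
    "a - 2 * b - d + f - e - 1 = 3 * (m - k + l - e)" "2 * a - b + c - d - e = 3 * (n + k - l - d)"
    by (simp_all add: algebra_simps)
  then have "3 dvd a - 2 * b + d - c - f - 1" "3 dvd 2 * a - b - c + e - f"
    "3 dvd a - 2 * b - d + f - e - 1" "3 dvd 2 * a - b + c - d - e"
    by (metis dvd_triv_left)+
  then show ?thesis
    using assms by (simp add: p dual_triples_def mem_eis_sets)
qed

text \<open>For entries \<open>1 + 3 \<alpha>\<close>, the inverse transform is integral with first entry \<open>1 + \<Sum>\<alpha>\<close>, and its other
entries are congruent to \<open>\<Sum>\<alpha>\<close> modulo \<open>\<theta>\<close>. Modulo 3, the sum of norms divided by 3 depends only on the
residue of \<open>\<Sum>\<alpha>\<close> modulo \<open>\<theta>\<close>, and it is 2 exactly when this residue is \<open>- 1\<close>.\<close>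
lemma dft_surj:
  assumes z: "z \<in> one_mod_3 \<times> one_mod_3 \<times> one_mod_3" and sum: "core_sum z = int (3 * n)" and n: "n mod 3 = 2"
  shows "z \<in> dft ` dual_triples"
proof -
  obtain z1 z2 z3 where zz: "z = (z1, z2, z3)" by (cases z)
  have ex: "\<exists>a b. z = (1 + 3 * a, 3 * b)" if "z \<in> one_mod_3" for z
    using that by (cases z) (auto simp: mem_eis_sets dvd_def, metis diff_add_cancel add.commute)
  from z zz ex obtain a1 b1 a2 b2 a3 b3 where
    zs: "z1 = (1 + 3 * a1, 3 * b1)" "z2 = (1 + 3 * a2, 3 * b2)" "z3 = (1 + 3 * a3, 3 * b3)"
    by (metis mem_Sigma_iff)
  \<comment> \<open>the two coordinates of \<open>\<Sum>\<alpha>\<close>\<close>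
  let ?A = "a1 + a2 + a3" and ?B = "b1 + b2 + b3"
  have "int n = 1 + 2 * ?A - ?B + 3 * (eis_norm (a1, b1) + eis_norm (a2, b2) + eis_norm (a3, b3))"
    using sum unfolding zz zs by (simp add: power2_eq_square algebra_simps)
  moreover obtain k where "int n = 3 * k + 2"
    using n by (metis mult_div_mod_eq of_nat_numeral zmod_int)
  ultimately have "?A + ?B + 1 = 3 * (?A + eis_norm (a1, b1) + eis_norm (a2, b2) + eis_norm (a3, b3) - k)"
    by simp
  then obtain j where j: "?A + ?B + 1 = 3 * j" ..
  define u v w where uvw: "u = (?B - j, j - 1 - ?A)" "v = (a1 - b2 + b3 - a3, b1 + a2 - b2 - a3)"
    "w = (a1 + b2 - a2 - b3, b1 - a2 + a3 - b3)"
  have dft: "dft (u, v, w) = z"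
    using j by (simp add: uvw zz zs)
  have "a1 - b2 + b3 - a3 + (b1 + a2 - b2 - a3) + 1 = 3 * (j - b2 - a3)"
    "a1 + b2 - a2 - b3 + (b1 - a2 + a3 - b3) + 1 = 3 * (j - a2 - b3)"
    using j by (simp_all add: algebra_simps)
  then have "3 dvd a1 - b2 + b3 - a3 + (b1 + a2 - b2 - a3) + 1" "3 dvd a1 + b2 - a2 - b3 + (b1 - a2 + a3 - b3) + 1"
    by (metis dvd_triv_left)+
  then have "v \<in> mod_\<theta> (- 1)" "w \<in> mod_\<theta> (- 1)"
    unfolding uvw mem_eis_sets diff_minus_eq_add by blast+
  then have "(u, v, w) \<in> dual_triples"
    using z by (simp add: dual_triples_def dft zz)
  with dft show ?thesis by force
qed

lemma mem_dual_triples: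
  "((a, b), (c, d), (e, f)) \<in> dual_triples \<longleftrightarrow> 3 dvd c + d + 1 \<and> 3 dvd e + f + 1 \<and> 3 dvd 2 * a - b + f + d"
proof -
  have "3 dvd a - 2 * b + c + e - 1 \<and> 3 dvd 2 * a - b + d + f \<longleftrightarrow> 3 dvd 2 * a - b + f + d"
    if "3 dvd c + d + 1" "3 dvd e + f + 1"
  proof -
    from that obtain k l where kl: "c + d + 1 = 3 * k" "e + f + 1 = 3 * l" by (auto simp: dvd_def)
    have eq: "a - 2 * b + c + e - 1 = 3 * (a - b + k + l - 1) - (2 * a - b + f + d)"
      using kl by (simp add: algebra_simps)
    have "3 dvd a - 2 * b + c + e - 1" if "3 dvd 2 * a - b + f + d"
      unfolding eq using that by (intro dvd_diff) simp_all
    moreover have "2 * a - b + d + f = 2 * a - b + f + d" by simp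
    ultimately show ?thesis by metis
  qed
  then show ?thesis by (auto simp: dual_triples_def mem_eis_sets)
qed

lemma rotation_residues:
  fixes c d q :: int
  assumes "3 dvd c + d + 1"
  shows "3 dvd q + d \<or> 3 dvd q + (c - d) \<or> 3 dvd q - c" "3 dvd q + d \<Longrightarrow> \<not> 3 dvd q + (c - d)"
    "3 dvd - d + (c - d) + 1"
  using assms by presburger+

text \<open>Multiplication of \<open>v\<close> by \<open>\<omega>\<close> moves \<open>\<theta> u + v + w\<close> through the three classes modulo 3 above 1 modulo
\<open>\<theta>\<close>, so the condition modulo 3 selects one triple out of three.\<close>
lemma theta_dual_triples: "theta dual_sum dual_triples = 3 * (dilate 3 a_series * c_series\<^sup>2)"
proof -
  let ?T = "UNIV \<times> (mod_\<theta> (- 1) \<times> mod_\<theta> (- 1))"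
  have sum: "dual_sum = (\<lambda>(u, p). int 3 * eis_norm u + (\<lambda>(v, w). eis_norm v + eis_norm w) p)"
    by auto
  have g3: "graded (\<lambda>u. int 3 * eis_norm u) UNIV"
    unfolding graded_def
  proof (intro conjI allI ballI)
    fix n
    have "{u \<in> UNIV. int 3 * eis_norm u = n} \<subseteq> {u \<in> UNIV. eis_norm u = n div 3}" by auto
    moreover have "finite {u \<in> UNIV. eis_norm u = n div 3}"
      using graded_eis_norm[of UNIV] by (simp only: graded_def)
    ultimately show "finite {u \<in> UNIV. int 3 * eis_norm u = n}" by (rule finite_subset)
  qed (simp add: eis_norm_nonneg del: eis_norm.simps)
  note g2 = graded_times[OF graded_eis_norm graded_eis_norm]
  have "theta dual_sum ?T = theta (\<lambda>u. int 3 * eis_norm u) UNIV * (theta eis_norm (mod_\<theta> (- 1)) * theta eis_norm (mod_\<theta> (- 1)))"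
    unfolding sum theta_times[OF graded_eis_norm graded_eis_norm] theta_times[OF g3 g2] ..
  also have "\<dots> = 9 * (dilate 3 a_series * c_series\<^sup>2)"
    using theta_scale[of 3 eis_norm UNIV]
    by (simp add: theta_mod_\<theta>_minus_1 a_series_def power2_eq_square algebra_simps)
  finally have T: "theta dual_sum ?T = 9 * (dilate 3 a_series * c_series\<^sup>2)" .
  have "theta dual_sum ?T = 3 * theta dual_sum dual_triples"
  proof (rule theta_orbit3[where \<rho> = "\<lambda>(u, v, w). (u, mult_\<omega> v, w)"])
    show "graded dual_sum ?T" unfolding sum by (rule graded_times[OF g3 g2])
    show "dual_triples \<subseteq> ?T" by (auto simp: dual_triples_def)
    fix p :: "eisenstein \<times> eisenstein \<times> eisenstein"
    obtain a b c d e f where p: "p = ((a, b), (c, d), (e, f))" by (cases p rule: dft.cases)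
    show "(\<lambda>(u, v, w). (u, mult_\<omega> v, w)) p \<in> ?T" if "p \<in> ?T"
      using that rotation_residues(3)[of c d] by (simp add: p mem_eis_sets)
    show "p \<in> dual_triples \<or> (\<lambda>(u, v, w). (u, mult_\<omega> v, w)) p \<in> dual_triples \<or>
        (\<lambda>(u, v, w). (u, mult_\<omega> v, w)) ((\<lambda>(u, v, w). (u, mult_\<omega> v, w)) p) \<in> dual_triples" if "p \<in> ?T"
    proof -
      from that have cd: "3 dvd c + d + 1" "3 dvd e + f + 1" by (simp_all add: p mem_eis_sets)
      show ?thesis
        using rotation_residues(1)[OF cd(1), of "2 * a - b + f"] cd rotation_residues(3)[OF cd(1)]
          rotation_residues(3)[OF rotation_residues(3)[OF cd(1)]]
        by (simp add: p mem_dual_triples)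
    qed
    show "(\<lambda>(u, v, w). (u, mult_\<omega> v, w)) p \<notin> dual_triples" if "p \<in> dual_triples"
      using that rotation_residues(2)[of c d "2 * a - b + f"] by (simp add: p mem_dual_triples)
  qed (auto simp: mult_\<omega>_cube eis_norm_mult_\<omega> simp del: eis_norm.simps mult_\<omega>.simps)
  with T have "3 * (theta dual_sum dual_triples - 3 * (dilate 3 a_series * c_series\<^sup>2)) = 0"
    by (simp add: algebra_simps)
  then have "theta dual_sum dual_triples - 3 * (dilate 3 a_series * c_series\<^sup>2) = 0"
    by (rule numeral_mult_fps_eq_0)
  then show ?thesis by simp
qed

text \<open>This is the part of a cubic identity of the Borwein brothers for \<open>c(q)\<^sup>3\<close> in terms of \<open>a(q\<^sup>3)\<close> and
\<open>c(q\<^sup>3)\<close> that concerns exponents congruent to 2 modulo 3.\<close>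
lemma c_series_cube_dissect:
  assumes n: "n mod 3 = 2"
  shows "(c_series * (c_series * c_series)) $ (3 * n) = 3 * (dilate 3 a_series * c_series\<^sup>2) $ n"
proof -
  let ?K = "one_mod_3 \<times> one_mod_3 \<times> one_mod_3"
  have "bij_betw dft {p\<in>dual_triples. dual_sum p = int n} {z\<in>?K. core_sum z = int (3 * n)}"
    unfolding bij_betw_def
  proof (intro conjI inj_dft equalityI subsetI)
    fix z assume "z \<in> dft ` {p\<in>dual_triples. dual_sum p = int n}"
    then obtain p where "z = dft p" "p \<in> dual_triples" "dual_sum p = int n" by blast
    then show "z \<in> {z\<in>?K. core_sum z = int (3 * n)}"
      using dft_mem core_sum_dft[of p] by simp
  next
    fix z assume "z \<in> {z\<in>?K. core_sum z = int (3 * n)}"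
    moreover from this obtain p where "z = dft p" "p \<in> dual_triples"
      using dft_surj[OF _ _ n, of z] by blast
    ultimately show "z \<in> dft ` {p\<in>dual_triples. dual_sum p = int n}"
      using core_sum_dft[of p] by simp
  qed
  then have "card {p\<in>dual_triples. dual_sum p = int n} = card {z\<in>?K. core_sum z = int (3 * n)}"
    by (rule bij_betw_same_card)
  moreover have "c_series * (c_series * c_series) = theta core_sum ?K"
  proof -
    have "core_sum = (\<lambda>(z, p). eis_norm z + (\<lambda>(z, w). eis_norm z + eis_norm w) p)" by auto
    then show ?thesis
      unfolding c_series_def by (simp only: theta_times graded_eis_norm graded_times)
  qed
  ultimately have "(c_series * (c_series * c_series)) $ (3 * n) = theta dual_sum dual_triples $ n"
    by (simp add: theta_nth)
  then show ?thesis by (simp add: theta_dual_triples numeral_fps_const)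
qed

section \<open>Sums of squares and the comparison of coefficients\<close>
definition "diag_norm = (\<lambda>(x :: int, y :: int). x\<^sup>2 + 3 * y\<^sup>2)"

text \<open>The form \<open>x\<^sup>2 + 3 y\<^sup>2\<close> is the norm of \<open>x + y \<theta>\<close>, and these numbers make up the classes 0 and 1
modulo 2.\<close>
lemma bij_betw_embed: "bij_betw (\<lambda>(x, y). (x + y, 2 * y)) UNIV (zero_mod_2 \<union> one_mod_2)"
  unfolding bij_betw_def
proof (intro conjI equalityI subsetI)
  fix z assume "z \<in> zero_mod_2 \<union> one_mod_2"
  then obtain x k where "z = (x, 2 * k)"
    by (cases z) (auto simp: mem_eis_sets elim!: evenE)
  then have "z = (\<lambda>(x, y). (x + y, 2 * y)) (x - k, k)" by simp
  then show "z \<in> range (\<lambda>(x, y). (x + y, 2 * y))" by blast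
qed (auto simp: inj_on_def mem_eis_sets)

lemma eis_norm_embed: "eis_norm (case z of (x, y) \<Rightarrow> (x + y, 2 * y)) = diag_norm z"
  by (cases z) (simp add: diag_norm_def power2_eq_square algebra_simps)

lemma theta_diag_norm: "theta diag_norm UNIV = dilate 4 a_series + o_series"
proof -
  have "theta diag_norm UNIV = theta eis_norm (zero_mod_2 \<union> one_mod_2)"
    by (rule theta_reindex[OF bij_betw_embed]) (rule eis_norm_embed)
  also have "\<dots> = theta eis_norm zero_mod_2 + theta eis_norm one_mod_2"
    by (rule theta_split) (auto simp: zero_mod_2_def one_mod_2_def)
  finally show ?thesis by (simp add: theta_even o_series_def)
qed

lemma graded_diag_norm: "graded diag_norm UNIV"
proof -
  have "finite {z \<in> UNIV. diag_norm z = n}" for n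
  proof (rule inj_on_finite)
    show "inj_on (\<lambda>(x, y). (x + y, 2 * y)) {z \<in> UNIV. diag_norm z = n}"
      by (auto simp: inj_on_def)
    show "(\<lambda>(x, y). (x + y, 2 * y)) ` {z \<in> UNIV. diag_norm z = n} \<subseteq> {z \<in> UNIV. eis_norm z = n}"
      using eis_norm_embed by auto
    show "finite {z \<in> UNIV. eis_norm z = n}"
      using graded_eis_norm[of UNIV] by (simp only: graded_def)
  qed
  then show ?thesis by (auto simp: graded_def diag_norm_def)
qed

lemma omega_eq_coeff: "int (omega n) = ((dilate 4 a_series + o_series) ^ 3) $ n"
proof -
  let ?q = "\<lambda>(z1, p). diag_norm z1 + (\<lambda>(z2, z3). diag_norm z2 + diag_norm z3) p"
  have "(dilate 4 a_series + o_series) ^ 3 = theta ?q (UNIV \<times> (UNIV \<times> UNIV))"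
    unfolding theta_diag_norm[symmetric] power3_eq_cube mult.assoc
    by (simp only: theta_times graded_diag_norm graded_times)
  moreover have "bij_betw (\<lambda>(x1, x2, x3, y1, y2, y3). ((x1, y1), (x2, y2), (x3, y3)))
      (omega_tuples n) {p \<in> UNIV \<times> (UNIV \<times> UNIV). ?q p = int n}"
    by (rule bij_betw_byWitness[where f' = "\<lambda>((x1, y1), (x2, y2), (x3, y3)). (x1, x2, x3, y1, y2, y3)"])
       (auto simp: omega_tuples_def diag_norm_def)
  ultimately show ?thesis
    by (simp add: omega_def theta_nth bij_betw_same_card)
qed

text \<open>In the cube of \<open>dilate 4 a_series + o_series\<close>, the even exponents come from the terms with an
even number of odd factors. By \<open>parallelogram\<close> these terms combine to
\<open>dilate 4 a_series * (dilate 2 a_series)\<^sup>2\<close>, a series in \<open>t\<^sup>2\<close>, so that the index can be halved.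
The same splitting by parity then applies once more.\<close>
lemma omega_double:
  assumes "odd n"
  shows "int (omega (2 * n)) = 6 * (dilate 2 a_series * dilate 4 a_series * o_series) $ n"
proof -
  define A1 A2 where A: "A1 = dilate 2 a_series" "A2 = dilate 4 a_series"
  have A1: "A1\<^sup>2 = A2\<^sup>2 + 3 * o_series\<^sup>2" unfolding A by (rule parallelogram)
  have a: "a_series = A2 + 3 * o_series" unfolding A by (rule a_series_mod_2)
  have supp: "supported 2 0 A1" "supported 2 0 A2" "supported 2 1 o_series"
    by (auto simp: A intro: supported_dilate_self o_series_supported_2[simplified])
  let ?R = "(3 * A2\<^sup>2 + o_series\<^sup>2) * o_series"
  have "supported 2 1 ?R"
    using supported_mult[OF supported_add[OF supported_numeral_mult[OF supported_power2[OF supp(2)]]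
        supported_cong[OF supported_power2[OF supp(3)]]] supp(3)] by simp
  then have R: "?R $ (2 * n) = 0" by (rule supported_nth) simp
  have "(A2 + o_series) ^ 3 = dilate 2 (A1 * a_series\<^sup>2) + ?R"
  proof -
    have "dilate 2 (A1 * a_series\<^sup>2) = A2 * A1\<^sup>2" by (simp add: A dilate_simps)
    then show ?thesis using A1 by algebra
  qed
  then have "((A2 + o_series) ^ 3) $ (2 * n) = (A1 * a_series\<^sup>2) $ n"
    using R by (simp add: dilate_nth)
  also have "A1 * a_series\<^sup>2 = 6 * (A1 * A2 * o_series) + A1 * (A2\<^sup>2 + 9 * o_series\<^sup>2)"
    by (subst a) (simp add: power2_eq_square algebra_simps)
  also have "\<dots> $ n = 6 * (A1 * A2 * o_series) $ n"
  proof -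
    have "supported 2 0 (A1 * (A2\<^sup>2 + 9 * o_series\<^sup>2))"
      using supported_mult[OF supp(1) supported_add[OF supported_power2[OF supp(2)]
        supported_numeral_mult[OF supported_cong[OF supported_power2[OF supp(3)]]]]] by simp
    then have "(A1 * (A2\<^sup>2 + 9 * o_series\<^sup>2)) $ n = 0"
      by (rule supported_nth) (use assms in presburger)
    then show ?thesis by (simp add: numeral_fps_const)
  qed
  finally show ?thesis by (simp add: omega_eq_coeff A)
qed

lemma omega_dissect:
  assumes "n mod 6 = 5"
  shows "int (omega (2 * n)) =
    36 * (2 * dilate 6 a_series * dilate 4 c_series * co_series + dilate 2 c_series * dilate 12 a_series * dilate 3 o_series) $ n"
proof -
  define a1 a2 o3 c1 c2 where defs: "a1 = dilate 6 a_series" "a2 = dilate 12 a_series"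
    "o3 = dilate 3 o_series" "c1 = dilate 2 c_series" "c2 = dilate 4 c_series"
  have "dilate 2 a_series = dilate 2 (dilate 3 a_series + 6 * c_series)"
    "dilate 4 a_series = dilate 4 (dilate 3 a_series + 6 * c_series)"
    by (simp_all only: a_series_mod_3[symmetric])
  then have *: "dilate 2 a_series = a1 + 6 * c1" "dilate 4 a_series = a2 + 6 * c2"
    by (simp_all add: dilate_simps defs)
  have **: "o_series = o3 + 2 * co_series"
    unfolding defs by (rule o_series_mod_3)
  have s: "supported 3 0 a1" "supported 3 0 a2" "supported 3 0 o3" "supported 3 2 c1" "supported 3 1 c2"
    "supported 3 1 co_series"
    unfolding defs using supported_dilate[OF _ c_series_supported, of 2]
      supported_dilate[OF _ c_series_supported, of 4, THEN supported_cong, of 1]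
    by (auto intro: supported_dilate_self co_series_supported_3[simplified])
  \<comment> \<open>the parts with exponents congruent to 0 and 1 modulo 3\<close>
  let ?R0 = "a1 * a2 * o3 + 12 * (c1 * a2 * co_series) + 36 * (c1 * c2 * o3)"
  let ?R1 = "2 * (a1 * a2 * co_series) + 6 * (a1 * c2 * o3) + 72 * (c1 * c2 * co_series)"
  have n: "odd n" "n mod 3 = 2" using assms by presburger+
  note m = supported_mult[OF supported_mult, THEN supported_cong]
  have "supported 3 0 ?R0"
    by (intro supported_add supported_numeral_mult m[OF s(1) s(2) s(3)] m[OF s(4) s(2) s(6)] m[OF s(4) s(5) s(3)]) simp_all
  then have R0: "?R0 $ n = 0" by (rule supported_nth) (simp add: n)
  have "supported 3 1 ?R1"
    by (intro supported_add supported_numeral_mult m[OF s(1) s(2) s(6)] m[OF s(1) s(5) s(3)] m[OF s(4) s(5) s(6)]) simp_all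
  then have R1: "?R1 $ n = 0" by (rule supported_nth) (simp add: n)
  have "(a1 + 6 * c1) * (a2 + 6 * c2) * (o3 + 2 * co_series) =
      6 * (2 * a1 * c2 * co_series + c1 * a2 * o3) + ?R0 + ?R1"
    by algebra
  then have "((a1 + 6 * c1) * (a2 + 6 * c2) * (o3 + 2 * co_series)) $ n = 6 * (2 * a1 * c2 * co_series + c1 * a2 * o3) $ n"
    using R0 R1 by (simp only: fps_add_nth) (simp add: numeral_fps_const)
  then show ?thesis
    using omega_double[OF n(1), unfolded * **] unfolding defs[symmetric] by (simp del: fps_add_nth)
qed

lemma B3_dissect:
  assumes "n mod 6 = 5"
  shows "int (B3 (n - 1)) = 3 * (2 * dilate 12 a_series * dilate 4 c_series * co_series
    + 3 * dilate 3 o_series * ((dilate 4 c_series)\<^sup>2 + co_series\<^sup>2)) $ n"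
proof -
  define a2 o3 c2 where defs: "a2 = dilate 12 a_series" "o3 = dilate 3 o_series" "c2 = dilate 4 c_series"
  have "dilate 3 a_series = dilate 3 (dilate 4 a_series + 3 * o_series)"
    by (simp only: a_series_mod_2[symmetric])
  then have *: "dilate 3 a_series = a2 + 3 * o3" by (simp add: dilate_simps defs)
  have **: "c_series = c2 + co_series" unfolding defs by (rule c_series_mod_2)
  have s: "supported 2 0 a2" "supported 2 0 c2" "supported 2 1 o3" "supported 2 1 co_series"
    unfolding defs using supported_dilate[OF _ o_series_supported_2, of 3, THEN supported_cong, of 1]
    by (auto intro: supported_dilate_self co_series_supported_2[simplified])
  have n: "odd n" "n mod 3 = 2" "3 * (n - 1) + 3 = 3 * n" using assms by presburger+
  let ?R = "a2 * (c2\<^sup>2 + co_series\<^sup>2) + 6 * (o3 * (c2 * co_series))"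
  have "supported 2 0 ?R"
    using supported_mult[OF s(1) supported_add[OF supported_power2[OF s(2)]
        supported_cong[OF supported_power2[OF s(4)]]]]
      supported_cong[OF supported_mult[OF s(3) supported_mult[OF s(2) s(4)]], of 0]
    by (intro supported_add supported_numeral_mult) simp_all
  then have R: "?R $ n = 0" by (rule supported_nth) (use n(1) in presburger)
  have "int (B3 (n - 1)) = 3 * ((a2 + 3 * o3) * (c2 + co_series)\<^sup>2) $ n"
    using B3_eq_coeff[of "n - 1"] c_series_cube_dissect[OF n(2)]
    unfolding n(3) by (simp only: * **[symmetric])
  also have "(a2 + 3 * o3) * (c2 + co_series)\<^sup>2 =
      (2 * a2 * c2 * co_series + 3 * o3 * (c2\<^sup>2 + co_series\<^sup>2)) + ?R"
    by algebra
  finally show ?thesis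
    using R unfolding defs by simp
qed

theorem theorem2p8:
  fixes n :: nat
  shows "omega (12 * n + 10) = 6 * B3 (6 * n + 4)"
proof -
  let ?m = "6 * n + 5"
  let ?L = "2 * dilate 6 a_series * dilate 4 c_series * co_series
    + dilate 2 c_series * dilate 12 a_series * dilate 3 o_series"
  let ?R = "2 * dilate 12 a_series * dilate 4 c_series * co_series
    + 3 * dilate 3 o_series * ((dilate 4 c_series)\<^sup>2 + co_series\<^sup>2)"
  have m: "?m mod 6 = 5" by presburger
  have "2 * ?L = ?R"
    using cubic_identities dissect_parallelogram(2) by algebra
  then have "2 * ?L $ ?m = ?R $ ?m"
    by (metis fps_mult_left_const_nth numeral_fps_const)
  moreover have "int (omega (2 * ?m)) = 36 * ?L $ ?m" by (rule omega_dissect[OF m])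
  moreover have "int (B3 (?m - 1)) = 3 * ?R $ ?m" by (rule B3_dissect[OF m])
  ultimately have "int (omega (2 * ?m)) = int (6 * B3 (?m - 1))" by simp
  moreover have "2 * ?m = 12 * n + 10" "?m - 1 = 6 * n + 4" by simp_all
  ultimately show ?thesis by (metis of_nat_eq_iff)
qed

end
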